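(* Assume each $f_i:\mathbb{R}^d\to\mathbb{R}$ ($i=1,\dots,n$) is $\mu$-strongly convex and $L$-smooth, let $f=\frac1n\sum_{i=1}^n f_i$, let $R$ be a closed convex regularizer, and let $x^\star$ be a minimizer of $f+R$. Consider the DIANA algorithm (described in the context) with an $\omega$-quantization operator $Q$ and stochastic gradients satisfying $\mathbb{E}[\|g_i^k-\nabla f_i(x^k)\|_2^2]\le\sigma_i^2$ for all $k\ge0$, $i=1,\dots,n$, with finite constants $\sigma_i$; set $\sigma^2=\frac1n\sum_{i=1}^n\sigma_i^2$. Let $$c=\frac{4\omega}{\alpha n},\qquad \alpha=\frac1{\omega+1},\qquad \gamma=\min\left\{\frac{2}{(\mu+L)\left(1+\frac{6\omega}{n}\right)},\ \frac{1}{2\mu(\omega+1)}\right\},\qquad \kappa=\frac{L+\mu}{2\mu}.$$ Then the conditions $\alpha\le\frac1{\omega+1}$, $c\ge\frac{4\omega}{\alpha n}$, $\gamma\le\frac{2}{(\mu+L)(1+\frac{2\omega}{n}+c\alpha)}$ and $\gamma\le\frac{\alpha}{2\mu}$ are satisfied, so that with $\Psi^k=\|x^k-x^\star\|_2^2+\frac{c\gamma^2}{n}\sum_{i=1}^n\|h_i^k-\nabla f_i(x^\star)\|_2^2$ one has $\mathbb{E}[\Psi^k]\le(1-\gamma\mu)^k\Psi^0+\frac{2}{\mu(\mu+L)}\sigma^2$, and the leading term in the iteration complexity bound is $$\frac1{\gamma\mu}=\kappa+\kappa\,\frac{2\omega}{n}+2(\omega+1).$$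
   Context: A differentiable $f$ is $\mu$-strongly convex ($\mu>0$) if $f(y)\ge f(x)+\langle\nabla f(x),y-x\rangle+\frac{\mu}{2}\|x-y\|_2^2$ for all $x,y$; it is $L$-smooth ($L>0$) if $f(y)\le f(x)+\langle\nabla f(x),y-x\rangle+\frac L2\|x-y\|_2^2$ for all $x,y$. The prox operator is $\mathrm{prox}_{\gamma R}(x)=\arg\min_y\{\gamma R(y)+\frac12\|y-x\|_2^2\}$, for $\gamma>0$ and $R:\mathbb{R}^d\to\mathbb{R}\cup\{+\infty\}$. An $\omega$-quantization operator is a random map $Q:\mathbb{R}^d\to\mathbb{R}^d$ such that for all $x\in\mathbb{R}^d$: $\mathbb{E}_Q[Q(x)]=x$ and $\mathbb{E}_Q[\|Q(x)\|_2^2]\le(\omega+1)\|x\|_2^2$. DIANA algorithm. Input: learning rates $\alpha,\gamma>0$, initial vectors $x^0,h_1^0,\dots,h_n^0\in\mathbb{R}^d$. For $k=0,1,2,\dots$: for each worker $i=1,\dots,n$, sample a stochastic gradient $g_i^k$ with conditional mean $\nabla f_i(x^k)$ given the history up to iteration $k$; set $\Delta_i^k=g_i^k-h_i^k$, $\hat\Delta_i^k=Q(\Delta_i^k)$, $h_i^{k+1}=h_i^k+\alpha\hat\Delta_i^k$, $\hat g_i^k=h_i^k+\hat\Delta_i^k$. Then set $\hat g^k=\frac1n\sum_{i=1}^n\hat g_i^k$ and $x^{k+1}=\mathrm{prox}_{\gamma R}(x^k-\gamma\hat g^k)$. Given the history, the stochastic gradients of different workers are independent, and each application of $Q$ uses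 fresh randomness, independent across workers.
   Formalization: The stated equality for 1/(γμ) is false (μ=L=1, ω=0, n=1 gives 2, not 3); proved instead: 1/(γμ)=max{κ+6κω/n, 2(ω+1)}, which lies between 1/2 and 3 times κ+2κω/n+2(ω+1), with the iteration complexity bound. R is assumed not identically +∞. *)

theory Defs
  imports "HOL-Probability.Probability"
begin

section \<open>Optimization\<close>

definition grad :: "('a::real_inner \<Rightarrow> real) \<Rightarrow> 'a \<Rightarrow> 'a" where
  "grad f x = (THE D. GDERIV f x :> D)"

definition strongly_convex :: "real \<Rightarrow> ('a::real_inner \<Rightarrow> real) \<Rightarrow> bool" where
  "strongly_convex \<mu> f \<longleftrightarrow> \<mu> > 0 \<and> (\<forall>x. f differentiable (at x)) \<and>
     (\<forall>x y. f y \<ge> f x + grad f x \<bullet> (y - x) + \<mu> / 2 * (norm (x - y))\<^sup>2)"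

definition smooth :: "real \<Rightarrow> ('a::real_inner \<Rightarrow> real) \<Rightarrow> bool" where
  "smooth L f \<longleftrightarrow> L > 0 \<and> (\<forall>x. f differentiable (at x)) \<and>
     (\<forall>x y. f y \<le> f x + grad f x \<bullet> (y - x) + L / 2 * (norm (x - y))\<^sup>2)"

text \<open>Closedness and convexity of an extended-real-valued function are those of its epigraph.
  Properness (a finite value somewhere) is included: without it every point minimizes the
  proximal objective, and the proximal point is not determined.\<close>

definition closed_convex_regularizer :: "('a::real_normed_vector \<Rightarrow> ereal) \<Rightarrow> bool" where
  "closed_convex_regularizer R \<longleftrightarrow>
     (\<forall>x. R x \<noteq> -\<infinity>) \<and> (\<exists>x. R x \<noteq> \<infinity>) \<and>
     closed {(x, r::real). R x \<le> ereal r} \<and> convex {(x, r::real). R x \<le> ereal r}"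

definition prox :: "real \<Rightarrow> ('a::real_normed_vector \<Rightarrow> ereal) \<Rightarrow> 'a \<Rightarrow> 'a" where
  "prox \<gamma> R x = arg_min (\<lambda>y. ereal \<gamma> * R y + ereal (1 / 2 * (norm (y - x))\<^sup>2)) (\<lambda>_. True)"

section \<open>Quantization and randomness\<close>

text \<open>A random map is given by a probability space \<open>Z\<close> of seeds and a jointly measurable
  \<open>Q\<close>; an application of the map draws a seed \<open>z\<close> from \<open>Z\<close> and returns \<open>Q z x\<close>.\<close>

definition quantization_operator ::
    "real \<Rightarrow> 'z measure \<Rightarrow> ('z \<Rightarrow> 'a::euclidean_space \<Rightarrow> 'a) \<Rightarrow> bool" where
  "quantization_operator \<omega> Z Q \<longleftrightarrow>
     prob_space Z \<and> (\<lambda>(z, x). Q z x) \<in> measurable (Z \<Otimes>\<^sub>M borel) borel \<and>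
     (\<forall>x. integrable Z (\<lambda>z. Q z x) \<and> integral\<^sup>L Z (\<lambda>z. Q z x) = x \<and>
          integrable Z (\<lambda>z. (norm (Q z x))\<^sup>2) \<and>
          integral\<^sup>L Z (\<lambda>z. (norm (Q z x))\<^sup>2) \<le> (\<omega> + 1) * (norm x)\<^sup>2)"

text \<open>\<open>has_cond_mean M F X Y\<close>: the conditional expectation of the vector \<open>X\<close> given \<open>F\<close> is \<open>Y\<close>,
  coordinate by coordinate.\<close>

definition has_cond_mean ::
    "'w measure \<Rightarrow> 'w measure \<Rightarrow> ('w \<Rightarrow> 'a::euclidean_space) \<Rightarrow> ('w \<Rightarrow> 'a) \<Rightarrow> bool" where
  "has_cond_mean M F X Y \<longleftrightarrow> integrable M X \<and>
     (\<forall>b\<in>Basis. AE w in M. real_cond_exp M F (\<lambda>v. X v \<bullet> b) w = Y w \<bullet> b)"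

text \<open>Since some of the \<open>A i\<close> may be the whole space, the product formula below covers all
  subfamilies.\<close>

definition cond_indep_vars ::
    "'w measure \<Rightarrow> 'w measure \<Rightarrow> 'b measure \<Rightarrow> ('i \<Rightarrow> 'w \<Rightarrow> 'b) \<Rightarrow> 'i set \<Rightarrow> bool" where
  "cond_indep_vars M F N X I \<longleftrightarrow> (\<forall>i\<in>I. X i \<in> measurable M N) \<and>
     (\<forall>A. (\<forall>i\<in>I. A i \<in> sets N) \<longrightarrow>
        (AE w in M. real_cond_exp M F (indicator {v \<in> space M. \<forall>i\<in>I. X i v \<in> A i}) w
           = (\<Prod>i\<in>I. real_cond_exp M F (indicator {v \<in> space M. X i v \<in> A i}) w)))"

text \<open>The seeds \<open>\<xi> i\<close>, \<open>i \<in> I\<close>, are drawn from \<open>Z\<close>, independently of each other and, jointly,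
  independently of the information \<open>G\<close>.\<close>

definition fresh_seeds ::
    "'w measure \<Rightarrow> 'w measure \<Rightarrow> 'z measure \<Rightarrow> ('i \<Rightarrow> 'w \<Rightarrow> 'z) \<Rightarrow> 'i set \<Rightarrow> bool" where
  "fresh_seeds M G Z \<xi> I \<longleftrightarrow>
     (\<forall>i\<in>I. \<xi> i \<in> measurable M Z \<and> distr M Z (\<xi> i) = Z) \<and>
     prob_space.indep_vars M (\<lambda>_. Z) \<xi> I \<and>
     prob_space.indep_set M (sets G)
       (sets (vimage_algebra (space M) (\<lambda>w. \<lambda>i\<in>I. \<xi> i w) (Pi\<^sub>M I (\<lambda>_. Z))))"

section \<open>The algorithm\<close>

text \<open>Workers are \<open>1, \<dots>, n\<close>; \<open>g i k\<close>, \<open>\<xi> i k\<close> and \<open>h i k\<close> belong to worker \<open>i\<close> in iteration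
  \<open>k\<close>. The seed \<open>\<xi> i k\<close> drives the quantization of the difference \<open>g i k - h i k\<close>.\<close>

definition quantized_diff ::
    "('z \<Rightarrow> 'a \<Rightarrow> 'a) \<Rightarrow> (nat \<Rightarrow> nat \<Rightarrow> 'w \<Rightarrow> 'z) \<Rightarrow> (nat \<Rightarrow> nat \<Rightarrow> 'w \<Rightarrow> 'a) \<Rightarrow>
     (nat \<Rightarrow> nat \<Rightarrow> 'w \<Rightarrow> 'a) \<Rightarrow> nat \<Rightarrow> nat \<Rightarrow> 'w \<Rightarrow> 'a::real_normed_vector" where
  "quantized_diff Q \<xi> g h i k w = Q (\<xi> i k w) (g i k w - h i k w)"

definition diana_run ::
    "'w measure \<Rightarrow> nat \<Rightarrow> real \<Rightarrow> real \<Rightarrow> ('a::real_normed_vector \<Rightarrow> ereal) \<Rightarrow> ('z \<Rightarrow> 'a \<Rightarrow> 'a) \<Rightarrow>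
     (nat \<Rightarrow> nat \<Rightarrow> 'w \<Rightarrow> 'z) \<Rightarrow> (nat \<Rightarrow> nat \<Rightarrow> 'w \<Rightarrow> 'a) \<Rightarrow> 'a \<Rightarrow> (nat \<Rightarrow> 'a) \<Rightarrow>
     (nat \<Rightarrow> 'w \<Rightarrow> 'a) \<Rightarrow> (nat \<Rightarrow> nat \<Rightarrow> 'w \<Rightarrow> 'a) \<Rightarrow> bool" where
  "diana_run M n \<alpha> \<gamma> R Q \<xi> g x0 h0 x h \<longleftrightarrow>
     (\<forall>w\<in>space M.
        x 0 w = x0 \<and> (\<forall>i\<in>{1..n}. h i 0 w = h0 i) \<and>
        (\<forall>k. (\<forall>i\<in>{1..n}. h i (Suc k) w = h i k w + \<alpha> *\<^sub>R quantized_diff Q \<xi> g h i k w) \<and>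
             x (Suc k) w = prox \<gamma> R (x k w - \<gamma> *\<^sub>R
               ((1 / real n) *\<^sub>R (\<Sum>i=1..n. h i k w + quantized_diff Q \<xi> g h i k w)))))"

text \<open>A history \<open>F\<close> of the run: \<open>F k\<close> contains at least all stochastic gradients and quantized
  differences of the iterations before \<open>k\<close>.\<close>

definition diana_history ::
    "'w measure \<Rightarrow> nat \<Rightarrow> (nat \<Rightarrow> 'w measure) \<Rightarrow> ('z \<Rightarrow> 'a \<Rightarrow> 'a) \<Rightarrow> (nat \<Rightarrow> nat \<Rightarrow> 'w \<Rightarrow> 'z) \<Rightarrow>
     (nat \<Rightarrow> nat \<Rightarrow> 'w \<Rightarrow> 'a) \<Rightarrow> (nat \<Rightarrow> nat \<Rightarrow> 'w \<Rightarrow> 'a::real_normed_vector) \<Rightarrow> bool" where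
  "diana_history M n F Q \<xi> g h \<longleftrightarrow>
     filtration (space M) F \<and> (\<forall>k. subalgebra M (F k)) \<and>
     (\<forall>k. \<forall>j<k. \<forall>i\<in>{1..n}. g i j \<in> borel_measurable (F k) \<and>
                             quantized_diff Q \<xi> g h i j \<in> borel_measurable (F k))"

text \<open>Everything known when iteration \<open>k\<close> quantizes: the history and the gradients of
  iteration \<open>k\<close>.\<close>

definition history_with_gradients ::
    "'w measure \<Rightarrow> nat \<Rightarrow> (nat \<Rightarrow> 'w measure) \<Rightarrow> (nat \<Rightarrow> nat \<Rightarrow> 'w \<Rightarrow> 'a::topological_space) \<Rightarrow>
     nat \<Rightarrow> 'w measure" where
  "history_with_gradients M n F g k =
     sigma (space M) (sets (F k) \<union> (\<Union>i\<in>{1..n}. {g i k -` A \<inter> space M | A. A \<in> sets borel}))"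

definition lyapunov ::
    "nat \<Rightarrow> (nat \<Rightarrow> 'a::real_inner \<Rightarrow> real) \<Rightarrow> real \<Rightarrow> real \<Rightarrow> 'a \<Rightarrow> 'a \<Rightarrow> (nat \<Rightarrow> 'a) \<Rightarrow> real" where
  "lyapunov n f c \<gamma> xs x h =
     (norm (x - xs))\<^sup>2 + c * \<gamma>\<^sup>2 / real n * (\<Sum>i=1..n. (norm (h i - grad (f i) xs))\<^sup>2)"

end

theory Submission
  imports Defs
begin

text \<open>One iteration of DIANA is a gradient step that is perturbed by two errors of mean zero: the noise
  of the stochastic gradients, which is centred given the history (\<open>cond_mean_error_orthogonal\<close>),
  and the quantization errors, which are centred given history and gradients and
  uncorrelated across workers, because fresh seeds are used (\<open>quantization_unbiased\<close>,
  \<open>quantization_errors_uncorrelated\<close>). By Pythagoras in \<open>L\<^sup>2\<close> the errors contribute only their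
  second moments. The proximal step cannot increase the distance to the solution
  (\<open>prox_nonexpansive\<close>), since the solution is a fixed point of the exact proximal gradient step.

  The second moment of a quantization error is at most \<open>\<omega>\<close> times that of the difference
  \<open>g i k - h i k\<close> (\<open>quantization_error_variance\<close>). Up to noise, this difference is bounded by the
  distance of the gradient and the distance of the shift \<open>h i k\<close> from the gradient at the solution.
  The first distance is paid by co-coercivity of gradients
  (\<open>gradient_cocoercive\<close>), which gives a negative multiple of exactly this quantity. The
  second one is paid by the shifts: each \<open>h i k\<close> performs a quantized averaging
  step towards the gradient, so its own distance contracts by \<open>1 - \<alpha>\<close> (\<open>h_step\<close>). The
  Lyapunov function weights the squared distances of the shifts against that of the iterate by a
  constant \<open>c\<close> for which the accounts balance (\<open>lyapunov_contraction_arithmetic\<close>), and it contracts by \<open>1 - \<gamma> \<mu>\<close> up to a constant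
  multiple of the variance. Iterating this gives \<open>expected_lyapunov_bound\<close>; the
  corollary inserts the parameters and evaluates \<open>1 / (\<gamma> \<mu>)\<close>.\<close>

section \<open>Smooth strongly convex functions and the proximal operator\<close>

lemma curvature_le:
  fixes f :: "'a::real_inner \<Rightarrow> real" and x y :: 'a
  assumes "strongly_convex \<mu> f" "smooth L f" "x \<noteq> y"
  shows "\<mu> \<le> L"
proof -
  have "f y \<ge> f x + grad f x \<bullet> (y - x) + \<mu> / 2 * (norm (x - y))\<^sup>2"
    using assms unfolding strongly_convex_def by blast
  moreover have "f y \<le> f x + grad f x \<bullet> (y - x) + L / 2 * (norm (x - y))\<^sup>2"
    using assms unfolding smooth_def by blast
  ultimately have "\<mu> / 2 * (norm (x - y))\<^sup>2 \<le> L / 2 * (norm (x - y))\<^sup>2" by linarith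
  then show ?thesis using assms(3) by simp
qed

text \<open>After subtracting the quadratic \<open>\<mu>/2 * (norm z)\<^sup>2\<close> from \<open>f\<close>, a convex function with
  curvature at most \<open>L - \<mu>\<close> remains, and \<open>w\<close> in the proof is the difference of its gradients. The
  two-sided quadratic bounds, compared at \<open>y + t w\<close> and at \<open>x - t w\<close>, give an inequality that is
  quadratic in \<open>t\<close>; the best \<open>t\<close> yields the co-coercivity of \<open>w\<close>.\<close>

lemma gradient_cocoercive:
  fixes f :: "'a::real_inner \<Rightarrow> real"
  assumes sc: "strongly_convex \<mu> f" and sm: "smooth L f"
  shows "(norm (grad f x - grad f y))\<^sup>2 + \<mu> * L * (norm (x - y))\<^sup>2
    \<le> (\<mu> + L) * ((grad f x - grad f y) \<bullet> (x - y))"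
proof (cases "x = y")
  case True
  then show ?thesis by simp
next
  case False
  define P S where "P = grad f x" and "S = grad f y"
  define d w where "d = x - y" and "w = P - S - \<mu> *\<^sub>R d"
  have \<mu>L: "\<mu> \<le> L" using curvature_le[OF sc sm False] .
  have key: "2 * t * (w \<bullet> w) - (L - \<mu>) * t\<^sup>2 * (w \<bullet> w) \<le> w \<bullet> d" for t
  proof -
    have lower: "f b \<ge> f a + grad f a \<bullet> (b - a) + \<mu> / 2 * (norm (a - b))\<^sup>2" for a b
      using sc unfolding strongly_convex_def by blast
    have upper: "f b \<le> f a + grad f a \<bullet> (b - a) + L / 2 * (norm (a - b))\<^sup>2" for a b
      using sm unfolding smooth_def by blast
    have "f x + P \<bullet> ((y + t *\<^sub>R w) - x) + \<mu> / 2 * (norm (x - (y + t *\<^sub>R w)))\<^sup>2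
        \<le> f y + S \<bullet> ((y + t *\<^sub>R w) - y) + L / 2 * (norm (y - (y + t *\<^sub>R w)))\<^sup>2"
      using lower[of x "y + t *\<^sub>R w"] upper[of "y + t *\<^sub>R w" y] unfolding P_def S_def by linarith
    moreover have "f y + S \<bullet> ((x - t *\<^sub>R w) - y) + \<mu> / 2 * (norm (y - (x - t *\<^sub>R w)))\<^sup>2
        \<le> f x + P \<bullet> ((x - t *\<^sub>R w) - x) + L / 2 * (norm (x - (x - t *\<^sub>R w)))\<^sup>2"
      using lower[of y "x - t *\<^sub>R w"] upper[of "x - t *\<^sub>R w" x] unfolding P_def S_def by linarith
    moreover have "(y + t *\<^sub>R w) - x = t *\<^sub>R w - d" "(x - t *\<^sub>R w) - y = d - t *\<^sub>R w"
      "x - (y + t *\<^sub>R w) = d - t *\<^sub>R w" "y - (x - t *\<^sub>R w) = t *\<^sub>R w - d"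
      by (simp_all add: d_def)
    ultimately have "P \<bullet> (t *\<^sub>R w - d) + S \<bullet> (d - t *\<^sub>R w) + \<mu> * (norm (d - t *\<^sub>R w))\<^sup>2
        \<le> S \<bullet> (t *\<^sub>R w) - P \<bullet> (t *\<^sub>R w) + L * (norm (t *\<^sub>R w))\<^sup>2"
      by (simp add: norm_minus_commute)
    moreover have "(norm (d - t *\<^sub>R w))\<^sup>2 = d \<bullet> d - 2 * t * (d \<bullet> w) + t\<^sup>2 * (w \<bullet> w)"
      "(norm (t *\<^sub>R w))\<^sup>2 = t\<^sup>2 * (w \<bullet> w)"
      unfolding power2_norm_eq_inner
      by (simp_all add: inner_diff_left inner_diff_right inner_commute[of w d]
          power2_eq_square algebra_simps)
    ultimately have "P \<bullet> (t *\<^sub>R w - d) + S \<bullet> (d - t *\<^sub>R w) + \<mu> * (d \<bullet> d - 2 * t * (d \<bullet> w) + t\<^sup>2 * (w \<bullet> w))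
        \<le> S \<bullet> (t *\<^sub>R w) - P \<bullet> (t *\<^sub>R w) + L * (t\<^sup>2 * (w \<bullet> w))"
      by simp
    then have "2 * t * ((P - S - \<mu> *\<^sub>R d) \<bullet> w) - (L - \<mu>) * t\<^sup>2 * (w \<bullet> w) \<le> (P - S - \<mu> *\<^sub>R d) \<bullet> d"
      by (simp add: inner_diff_left inner_diff_right algebra_simps)
    then show ?thesis by (simp only: w_def[symmetric])
  qed
  have "w \<bullet> w \<le> (L - \<mu>) * (w \<bullet> d)"
  proof (cases "L = \<mu>")
    case True
    \<comment> \<open>Here the inequality is linear in \<open>t\<close> and bounded, so its slope vanishes.\<close>
    have "w \<bullet> w = 0"
    proof (rule ccontr)
      assume "w \<bullet> w \<noteq> 0"
      then have "2 * ((\<bar>w \<bullet> d\<bar> + 1) / (w \<bullet> w)) * (w \<bullet> w) = 2 * (\<bar>w \<bullet> d\<bar> + 1)" by simp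
      then show False using key[of "(\<bar>w \<bullet> d\<bar> + 1) / (w \<bullet> w)"] True by simp
    qed
    then show ?thesis using True by simp
  next
    case False
    then have pos: "L - \<mu> > 0" using \<mu>L by simp
    have "(w \<bullet> w) / (L - \<mu>) \<le> w \<bullet> d"
      using key[of "1 / (L - \<mu>)"] pos by (simp add: power2_eq_square)
    then show ?thesis using pos by (simp add: divide_le_eq mult.commute)
  qed
  then show ?thesis
    unfolding P_def[symmetric] S_def[symmetric] d_def[symmetric] w_def power2_norm_eq_inner
    by (simp add: inner_diff_left inner_diff_right inner_commute algebra_simps)
qed

text \<open>By co-coercivity and Cauchy-Schwarz, \<open>norm (grad f x - grad f y)\<close> lies between the roots
  \<open>\<mu> * norm (x - y)\<close> and \<open>L * norm (x - y)\<close> of a quadratic polynomial.\<close>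

lemma gradient_lipschitz:
  fixes f :: "'a::real_inner \<Rightarrow> real"
  assumes sc: "strongly_convex \<mu> f" and sm: "smooth L f"
  shows "norm (grad f x - grad f y) \<le> L * norm (x - y)"
proof (cases "x = y")
  case True
  then show ?thesis by simp
next
  case False
  define G D where "G = norm (grad f x - grad f y)" and "D = norm (x - y)"
  have pos: "\<mu> > 0" "L > 0" using sc sm by (auto simp: strongly_convex_def smooth_def)
  have \<mu>L: "\<mu> \<le> L" using curvature_le[OF sc sm False] .
  have "(grad f x - grad f y) \<bullet> (x - y) \<le> G * D"
    unfolding G_def D_def by (rule norm_cauchy_schwarz)
  then have "(\<mu> + L) * ((grad f x - grad f y) \<bullet> (x - y)) \<le> (\<mu> + L) * (G * D)"
    using pos by (simp add: mult_left_mono)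
  with gradient_cocoercive[OF sc sm, of x y]
  have le: "(G - L * D) * (G - \<mu> * D) \<le> 0"
    unfolding G_def[symmetric] D_def[symmetric] by (simp add: algebra_simps power2_eq_square)
  have "D > 0" using False by (simp add: D_def)
  have "G \<le> L * D"
  proof (rule ccontr)
    assume "\<not> G \<le> L * D"
    then have "G > L * D" by simp
    moreover have "\<mu> * D \<le> L * D" using \<mu>L \<open>D > 0\<close> by simp
    ultimately have "(G - L * D) * (G - \<mu> * D) > 0" by (intro mult_pos_pos) linarith+
    with le show False by simp
  qed
  then show ?thesis by (simp add: G_def D_def)
qed

text \<open>First-order optimality: convexity makes \<open>R\<close> at most affine on the segment from \<open>p\<close>
  to \<open>y\<close>, and the quadratic upper bound says that \<open>F\<close> is affine there up to a second-order term; the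
  comparison is divided by the length \<open>t\<close> of the step, and \<open>t\<close> tends to \<open>0\<close>. The values
  \<open>rp\<close> and \<open>r\<close> describe points of the epigraph, which avoids arithmetic with infinite values.
  The lemma serves twice: for the objective \<open>f + R\<close> and for the objective that defines the
  proximal point.\<close>

lemma regularizer_subgradient_at_minimizer:
  fixes R :: "'a::real_inner \<Rightarrow> ereal"
  assumes R: "closed_convex_regularizer R"
    and upper: "\<And>y. F y \<le> F p + v \<bullet> (y - p) + C * (norm (y - p))\<^sup>2"
    and min: "\<And>y. ereal (F p) + ereal rp \<le> ereal (F y) + R y"
    and rp: "R p \<le> ereal rp" and r: "R y \<le> ereal r"
  shows "rp - v \<bullet> (y - p) \<le> r"
proof -
  let ?E = "{(x, r::real). R x \<le> ereal r}"
  define K where "K = C * (norm (y - p))\<^sup>2"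
  have slope: "rp - r \<le> v \<bullet> (y - p) + t * K" if t: "0 < t" "t \<le> 1" for t
  proof -
    have "convex ?E" using R by (simp add: closed_convex_regularizer_def)
    then have "(1 - t) *\<^sub>R (p, rp) + t *\<^sub>R (y, r) \<in> ?E"
      using rp r t by (intro convexD_alt) auto
    moreover have "(1 - t) *\<^sub>R p + t *\<^sub>R y = p + t *\<^sub>R (y - p)" by (simp add: algebra_simps)
    ultimately have "R (p + t *\<^sub>R (y - p)) \<le> ereal ((1 - t) * rp + t * r)" by simp
    then have "ereal (F p) + ereal rp
        \<le> ereal (F (p + t *\<^sub>R (y - p))) + ereal ((1 - t) * rp + t * r)"
      using min[of "p + t *\<^sub>R (y - p)"] by (meson add_left_mono order_trans)
    then have "F p + rp \<le> F (p + t *\<^sub>R (y - p)) + ((1 - t) * rp + t * r)" by simp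
    moreover have "F (p + t *\<^sub>R (y - p)) \<le> F p + t * (v \<bullet> (y - p)) + t\<^sup>2 * K"
      using upper[of "p + t *\<^sub>R (y - p)"] by (simp add: K_def power_mult_distrib mult_ac)
    ultimately have "t * (rp - r) \<le> t * (v \<bullet> (y - p) + t * K)"
      by (simp add: algebra_simps power2_eq_square)
    then show ?thesis using t by simp
  qed
  have "((\<lambda>t. v \<bullet> (y - p) + t * K) \<longlongrightarrow> v \<bullet> (y - p) + 0 * K) (at_right 0)"
    by (intro tendsto_intros)
  moreover have "eventually (\<lambda>t. rp - r \<le> v \<bullet> (y - p) + t * K) (at_right 0)"
    unfolding eventually_at_right_field by (intro exI[of _ 1]) (auto intro: slope)
  ultimately have "rp - r \<le> v \<bullet> (y - p) + 0 * K"
    by (rule tendsto_lowerbound) simp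
  then show ?thesis by simp
qed

text \<open>A minimizer must be shown to exist, because \<open>prox\<close> picks one by a choice operator. The
  affine minorant of \<open>R\<close> (in the application, the one at the minimizer of \<open>f + R\<close>) and the
  quadratic term confine the relevant part of the closed epigraph to a bounded set, so that the
  objective, a continuous function on the epigraph, attains its infimum.\<close>

lemma prox_is_arg_min:
  fixes R :: "'a::euclidean_space \<Rightarrow> ereal"
  assumes R: "closed_convex_regularizer R" and \<gamma>: "\<gamma> > 0"
    and fin: "R xs \<le> ereal rs"
    and minorant: "\<And>y r. R y \<le> ereal r \<Longrightarrow> rs - v \<bullet> (y - xs) \<le> r"
  shows "is_arg_min (\<lambda>y. ereal \<gamma> * R y + ereal (1 / 2 * (norm (y - z))\<^sup>2)) (\<lambda>_. True) (prox \<gamma> R z)"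
proof -
  let ?E = "{(x, r::real). R x \<le> ereal r}"
  define obj where "obj = (\<lambda>p::'a \<times> real. \<gamma> * snd p + 1 / 2 * (norm (fst p - z))\<^sup>2)"
  define m where "m = obj (xs, rs)"
  define T where "T = ?E \<inter> {p. obj p \<le> m}"
  have cont: "continuous_on S obj" for S
    unfolding obj_def by (intro continuous_intros)
  have "closed T"
    unfolding T_def using R
    by (intro closed_Int closed_Collect_le cont continuous_intros)
       (simp_all add: closed_convex_regularizer_def)
  moreover have "bounded T"
  proof -
    define B where "B = m - \<gamma> * rs + \<gamma> * (v \<bullet> (z - xs))"
    define K where "K = 4 * B + 4 * \<gamma>\<^sup>2 * (norm v)\<^sup>2"
    define \<rho> where "\<rho> = norm v * (sqrt K + norm (z - xs))"
    have "T \<subseteq> cball z (sqrt K) \<times> {rs - \<rho> .. m / \<gamma>}"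
    proof (clarify, intro conjI SigmaI)
      fix y r assume "(y, r) \<in> T"
      then have r: "rs - v \<bullet> (y - xs) \<le> r" and le: "\<gamma> * r + 1 / 2 * (norm (y - z))\<^sup>2 \<le> m"
        using minorant by (auto simp: T_def obj_def)
      have "\<gamma> * (rs - v \<bullet> (y - xs)) \<le> \<gamma> * r" using r \<gamma> by simp
      then have "1 / 2 * (norm (y - z))\<^sup>2 \<le> B + \<gamma> * (v \<bullet> (y - z))"
        using le by (simp add: B_def inner_diff_right algebra_simps)
      also have "\<gamma> * (v \<bullet> (y - z)) \<le> \<gamma> * (norm v * norm (y - z))"
        using \<gamma> by (intro mult_left_mono norm_cauchy_schwarz) simp
      also have "\<dots> \<le> \<gamma>\<^sup>2 * (norm v)\<^sup>2 + 1 / 4 * (norm (y - z))\<^sup>2"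
        using zero_le_power2[of "\<gamma> * norm v - 1 / 2 * norm (y - z)"]
        by (simp add: power2_eq_square algebra_simps)
      finally have "(norm (y - z))\<^sup>2 \<le> K" by (simp add: K_def)
      then have nb: "norm (y - z) \<le> sqrt K" by (simp add: real_le_rsqrt)
      then show "y \<in> cball z (sqrt K)" by (simp add: dist_norm norm_minus_commute)
      have "v \<bullet> (y - xs) \<le> norm v * norm (y - xs)" by (rule norm_cauchy_schwarz)
      also have "norm (y - xs) \<le> norm (y - z) + norm (z - xs)"
        using norm_triangle_ineq[of "y - z" "z - xs"] by simp
      finally have "v \<bullet> (y - xs) \<le> \<rho>"
        unfolding \<rho>_def using nb
        by (meson add_right_mono mult_left_mono norm_ge_zero order_trans)
      moreover have "\<gamma> * r \<le> m" using le zero_le_power2[of "norm (y - z)"] by linarith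
      then have "r \<le> m / \<gamma>" using \<gamma> by (simp add: pos_le_divide_eq mult.commute)
      ultimately show "r \<in> {rs - \<rho> .. m / \<gamma>}" using r by simp
    qed
    then show ?thesis
      by (rule bounded_subset[rotated]) (intro bounded_Times bounded_cball bounded_closed_interval)
  qed
  ultimately have "compact T" by (simp add: compact_eq_bounded_closed)
  moreover have "(xs, rs) \<in> T" using fin by (simp add: T_def m_def)
  ultimately obtain q where q: "q \<in> T" "\<And>p. p \<in> T \<Longrightarrow> obj q \<le> obj p"
    using continuous_attains_inf[of T obj] cont by blast
  obtain p r where qpr: "q = (p, r)" by (cases q)
  have least: "obj (p, r) \<le> obj (y, s)" if "R y \<le> ereal s" for y s
  proof (cases "obj (y, s) \<le> m")
    case True
    then show ?thesis using q(2)[of "(y, s)"] that by (simp add: T_def qpr)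
  next
    case False
    then show ?thesis using q(1) by (simp add: T_def qpr)
  qed
  have "is_arg_min (\<lambda>y. ereal \<gamma> * R y + ereal (1 / 2 * (norm (y - z))\<^sup>2)) (\<lambda>_. True) p"
  proof (unfold is_arg_min_linorder, intro conjI allI impI TrueI)
    fix y
    have "R p \<le> ereal r" using q(1) by (simp add: T_def qpr)
    then have "ereal \<gamma> * R p \<le> ereal \<gamma> * ereal r" using \<gamma> by (intro ereal_mult_left_mono) auto
    then have "ereal \<gamma> * R p + ereal (1 / 2 * (norm (p - z))\<^sup>2)
        \<le> ereal (\<gamma> * r) + ereal (1 / 2 * (norm (p - z))\<^sup>2)"
      by (intro add_right_mono) simp
    also have "\<dots> = ereal (obj (p, r))" by (simp add: obj_def)
    also have "\<dots> \<le> ereal \<gamma> * R y + ereal (1 / 2 * (norm (y - z))\<^sup>2)"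
    proof (cases "R y")
      case (real s)
      then show ?thesis using least[of y s] by (simp add: obj_def)
    next
      case PInf
      then show ?thesis using \<gamma> by simp
    next
      case MInf
      then show ?thesis using R by (simp add: closed_convex_regularizer_def)
    qed
    finally show "ereal \<gamma> * R p + ereal (1 / 2 * (norm (p - z))\<^sup>2)
        \<le> ereal \<gamma> * R y + ereal (1 / 2 * (norm (y - z))\<^sup>2)" .
  qed
  then show ?thesis unfolding prox_def arg_min_def by (rule someI)
qed

text \<open>The vector \<open>(z - p) / \<gamma>\<close> is a subgradient of \<open>R\<close> at the proximal point
  \<open>p = prox \<gamma> R z\<close>.\<close>

lemma prox_variational:
  fixes R :: "'a::euclidean_space \<Rightarrow> ereal"
  assumes R: "closed_convex_regularizer R" and \<gamma>: "\<gamma> > 0"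
    and fin: "R xs \<le> ereal rs"
    and minorant: "\<And>y r. R y \<le> ereal r \<Longrightarrow> rs - v \<bullet> (y - xs) \<le> r"
  obtains rp where "R (prox \<gamma> R z) = ereal rp"
    "\<And>y r. R y \<le> ereal r \<Longrightarrow> rp + (1 / \<gamma>) * ((z - prox \<gamma> R z) \<bullet> (y - prox \<gamma> R z)) \<le> r"
proof -
  define p where "p = prox \<gamma> R z"
  have nm: "R y \<noteq> -\<infinity>" for y using R by (simp add: closed_convex_regularizer_def)
  have min: "ereal \<gamma> * R p + ereal (1 / 2 * (norm (p - z))\<^sup>2)
      \<le> ereal \<gamma> * R y + ereal (1 / 2 * (norm (y - z))\<^sup>2)" for y
    using prox_is_arg_min[OF assms, of z] by (simp add: is_arg_min_linorder p_def)
  obtain sx where sx: "R xs = ereal sx" using fin nm[of xs] by (cases "R xs") auto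
  obtain rp where rp: "R p = ereal rp"
    using min[of xs] nm[of p] sx \<gamma> by (cases "R p") auto
  define F where "F = (\<lambda>y. 1 / (2 * \<gamma>) * (norm (y - z))\<^sup>2)"
  have exp: "F y = F p + ((1 / \<gamma>) *\<^sub>R (p - z)) \<bullet> (y - p) + 1 / (2 * \<gamma>) * (norm (y - p))\<^sup>2" for y
    using \<gamma> by (simp add: F_def power2_norm_eq_inner inner_diff_left inner_diff_right field_simps
        inner_commute)
  have "ereal (F p) + ereal rp \<le> ereal (F y) + R y" for y
  proof (cases "R y")
    case (real s)
    have "\<gamma> * rp + 1 / 2 * (norm (p - z))\<^sup>2 \<le> \<gamma> * s + 1 / 2 * (norm (y - z))\<^sup>2"
      using min[of y] rp real by simp
    then have "(\<gamma> * rp + 1 / 2 * (norm (p - z))\<^sup>2) / \<gamma> \<le> (\<gamma> * s + 1 / 2 * (norm (y - z))\<^sup>2) / \<gamma>"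
      using \<gamma> by (intro divide_right_mono) auto
    then have "F p + rp \<le> F y + s" using \<gamma> by (simp add: F_def add_divide_distrib)
    then show ?thesis using real by simp
  qed (use nm[of y] in auto)
  then have least: "ereal (F p) + ereal rp \<le> ereal (F y) + R y" for y .
  have upper: "F y \<le> F p + ((1 / \<gamma>) *\<^sub>R (p - z)) \<bullet> (y - p) + 1 / (2 * \<gamma>) * (norm (y - p))\<^sup>2" for y
    using exp[of y] by (rule eq_refl)
  show ?thesis
  proof (rule that)
    show "R (prox \<gamma> R z) = ereal rp" using rp by (simp add: p_def)
    fix y r assume "R y \<le> ereal r"
    with rp have "rp - ((1 / \<gamma>) *\<^sub>R (p - z)) \<bullet> (y - p) \<le> r"
      by (intro regularizer_subgradient_at_minimizer[OF R upper least]) simp_all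
    moreover have "((1 / \<gamma>) *\<^sub>R (p - z)) \<bullet> (y - p) = - ((1 / \<gamma>) * ((z - p) \<bullet> (y - p)))"
      by (simp only: inner_scaleR_left minus_diff_eq[of z p, symmetric] inner_minus_left mult_minus_right)
    ultimately show "rp + (1 / \<gamma>) * ((z - prox \<gamma> R z) \<bullet> (y - prox \<gamma> R z)) \<le> r"
      unfolding p_def by linarith
  qed
qed

text \<open>If \<open>a - p\<close> and \<open>b - q\<close> are subgradients at \<open>p\<close> and \<open>q\<close> of one convex
  function, monotonicity of subgradients is the hypothesis.\<close>

lemma norm_diff_le_if_monotone:
  fixes a b p q :: "'a::real_inner"
  assumes "(a - p) \<bullet> (q - p) + (b - q) \<bullet> (p - q) \<le> 0"
  shows "norm (p - q) \<le> norm (a - b)"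
proof -
  have "(norm (p - q))\<^sup>2 \<le> (a - b) \<bullet> (p - q)"
    using assms by (simp add: power2_norm_eq_inner inner_diff_left inner_diff_right algebra_simps)
  also have "\<dots> \<le> norm (a - b) * norm (p - q)" by (rule norm_cauchy_schwarz)
  finally show ?thesis
    by (cases "p = q") (simp_all add: power2_eq_square)
qed

text \<open>The second part compares a proximal point with \<open>xs\<close>, which is itself the proximal point of
  \<open>xs - \<gamma> v\<close> since \<open>- v\<close> is a subgradient of \<open>R\<close> at \<open>xs\<close>.\<close>

lemma prox_nonexpansive:
  fixes R :: "'a::euclidean_space \<Rightarrow> ereal"
  assumes R: "closed_convex_regularizer R" and \<gamma>: "\<gamma> > 0"
    and fin: "R xs \<le> ereal rs"
    and minorant: "\<And>y r. R y \<le> ereal r \<Longrightarrow> rs - v \<bullet> (y - xs) \<le> r"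
  shows "norm (prox \<gamma> R a - prox \<gamma> R b) \<le> norm (a - b)"
    and "norm (prox \<gamma> R a - xs) \<le> norm (a - (xs - \<gamma> *\<^sub>R v))"
proof -
  obtain ra where ra: "R (prox \<gamma> R a) = ereal ra"
    "\<And>y r. R y \<le> ereal r \<Longrightarrow> ra + (1 / \<gamma>) * ((a - prox \<gamma> R a) \<bullet> (y - prox \<gamma> R a)) \<le> r"
    using prox_variational[OF assms, of a] by blast
  obtain rb where rb: "R (prox \<gamma> R b) = ereal rb"
    "\<And>y r. R y \<le> ereal r \<Longrightarrow> rb + (1 / \<gamma>) * ((b - prox \<gamma> R b) \<bullet> (y - prox \<gamma> R b)) \<le> r"
    using prox_variational[OF assms, of b] by blast
  have "(1 / \<gamma>) * ((a - prox \<gamma> R a) \<bullet> (prox \<gamma> R b - prox \<gamma> R a) +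
      (b - prox \<gamma> R b) \<bullet> (prox \<gamma> R a - prox \<gamma> R b)) \<le> 0"
    using ra(2)[of "prox \<gamma> R b" rb] rb(2)[of "prox \<gamma> R a" ra] ra(1) rb(1)
    by (simp add: distrib_left)
  then show "norm (prox \<gamma> R a - prox \<gamma> R b) \<le> norm (a - b)"
    using \<gamma> by (intro norm_diff_le_if_monotone) (simp add: divide_le_0_iff)
  have "(1 / \<gamma>) * ((a - prox \<gamma> R a) \<bullet> (xs - prox \<gamma> R a)) \<le> v \<bullet> (prox \<gamma> R a - xs)"
    using ra(2)[of xs rs] fin minorant[of "prox \<gamma> R a" ra] ra(1) by simp
  then have "(a - prox \<gamma> R a) \<bullet> (xs - prox \<gamma> R a) \<le> \<gamma> * (v \<bullet> (prox \<gamma> R a - xs))"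
    using \<gamma> by (simp add: divide_le_eq mult.commute)
  then show "norm (prox \<gamma> R a - xs) \<le> norm (a - (xs - \<gamma> *\<^sub>R v))"
    by (intro norm_diff_le_if_monotone) (simp add: inner_diff_left)
qed

lemma prox_borel_measurable:
  fixes R :: "'a::euclidean_space \<Rightarrow> ereal"
  assumes "closed_convex_regularizer R" "\<gamma> > 0" "R xs \<le> ereal rs"
    "\<And>y r. R y \<le> ereal r \<Longrightarrow> rs - v \<bullet> (y - xs) \<le> r"
  shows "prox \<gamma> R \<in> borel_measurable borel"
proof -
  have "1-lipschitz_on UNIV (prox \<gamma> R)"
    using prox_nonexpansive(1)[OF assms] by (intro lipschitz_onI) (auto simp: dist_norm)
  then have "continuous_on UNIV (prox \<gamma> R)" by (rule lipschitz_on_continuous_on)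
  then show ?thesis by (rule borel_measurable_continuous_onI)
qed

section \<open>Square-integrable random vectors\<close>

definition square_integrable :: "'w measure \<Rightarrow> ('w \<Rightarrow> 'a::euclidean_space) \<Rightarrow> bool" where
  "square_integrable M X \<longleftrightarrow> X \<in> borel_measurable M \<and> integrable M (\<lambda>w. (norm (X w))\<^sup>2)"

lemma square_integrable_measurable: "square_integrable M X \<Longrightarrow> X \<in> borel_measurable M"
  by (simp add: square_integrable_def)

lemma square_integrable_norm_sq: "square_integrable M X \<Longrightarrow> integrable M (\<lambda>w. (norm (X w))\<^sup>2)"
  by (simp add: square_integrable_def)

lemma square_integrable_inner:
  fixes X Y :: "'w \<Rightarrow> 'a::euclidean_space"
  assumes "square_integrable M X" "square_integrable M Y"
  shows "integrable M (\<lambda>w. X w \<bullet> Y w)"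
proof (rule Bochner_Integration.integrable_bound)
  show "integrable M (\<lambda>w. (norm (X w))\<^sup>2 + (norm (Y w))\<^sup>2)"
    using assms by (intro Bochner_Integration.integrable_add) (simp_all add: square_integrable_def)
  show "(\<lambda>w. X w \<bullet> Y w) \<in> borel_measurable M"
    using assms by (auto simp: square_integrable_def)
  have "\<bar>a \<bullet> b\<bar> \<le> (norm a)\<^sup>2 + (norm b)\<^sup>2" for a b :: 'a
  proof -
    have "2 * \<bar>a \<bullet> b\<bar> \<le> 2 * (norm a * norm b)" using Cauchy_Schwarz_ineq2[of a b] by simp
    also have "\<dots> \<le> (norm a)\<^sup>2 + (norm b)\<^sup>2"
      using sum_squares_bound[of "norm a" "norm b"] by simp
    finally show ?thesis using zero_le_power2[of "norm a"] zero_le_power2[of "norm b"] by linarith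
  qed
  then show "AE w in M. norm (X w \<bullet> Y w) \<le> norm ((norm (X w))\<^sup>2 + (norm (Y w))\<^sup>2)"
    by simp
qed

lemma square_integrable_add:
  fixes X Y :: "'w \<Rightarrow> 'a::euclidean_space"
  assumes "square_integrable M X" "square_integrable M Y"
  shows "square_integrable M (\<lambda>w. X w + Y w)"
proof -
  have "(norm (a + b))\<^sup>2 = (norm a)\<^sup>2 + 2 * (a \<bullet> b) + (norm b)\<^sup>2" for a b :: 'a
    unfolding power2_norm_eq_inner by (simp add: inner_add_left inner_add_right inner_commute)
  moreover have "(\<lambda>w. X w + Y w) \<in> borel_measurable M"
    using assms by (intro borel_measurable_add square_integrable_measurable)
  ultimately show ?thesis
    using assms square_integrable_inner[OF assms] by (simp add: square_integrable_def)
qed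

lemma square_integrable_scaleR:
  "square_integrable M X \<Longrightarrow> square_integrable M (\<lambda>w. r *\<^sub>R X w)"
  by (auto simp: square_integrable_def power_mult_distrib)

lemma square_integrable_diff:
  assumes "square_integrable M X" "square_integrable M Y"
  shows "square_integrable M (\<lambda>w. X w - Y w)"
  using square_integrable_add[OF assms(1) square_integrable_scaleR[OF assms(2), of "-1"]] by simp

lemma (in finite_measure) square_integrable_const: "square_integrable M (\<lambda>w. v)"
  by (simp add: square_integrable_def)

lemma (in finite_measure) square_integrable_sum:
  "(\<And>i. i \<in> I \<Longrightarrow> square_integrable M (X i)) \<Longrightarrow> square_integrable M (\<lambda>w. \<Sum>i\<in>I. X i w)"
  by (induction I rule: infinite_finite_induct)
     (auto intro: square_integrable_add square_integrable_const)

lemma square_integrable_bound: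
  assumes "square_integrable M Y" "X \<in> borel_measurable M"
    and "\<And>w. w \<in> space M \<Longrightarrow> norm (X w) \<le> r * norm (Y w)"
  shows "square_integrable M X"
proof -
  have "integrable M (\<lambda>w. r\<^sup>2 * (norm (Y w))\<^sup>2)"
    using assms(1) by (simp add: square_integrable_def)
  then have "integrable M (\<lambda>w. (norm (X w))\<^sup>2)"
  proof (rule Bochner_Integration.integrable_bound)
    show "AE w in M. norm ((norm (X w))\<^sup>2) \<le> norm (r\<^sup>2 * (norm (Y w))\<^sup>2)"
    proof (rule AE_I2)
      fix w assume "w \<in> space M"
      then have "(norm (X w))\<^sup>2 \<le> (r * norm (Y w))\<^sup>2" using assms(3) by (intro power_mono) auto
      then show "norm ((norm (X w))\<^sup>2) \<le> norm (r\<^sup>2 * (norm (Y w))\<^sup>2)"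
        by (simp add: power_mult_distrib)
    qed
  qed (use assms(2) in measurable)
  then show ?thesis using assms(2) by (simp add: square_integrable_def)
qed

text \<open>Pythagoras in \<open>L\<^sup>2\<close>. All error terms of the algorithm enter the estimates through this
  lemma.\<close>

lemma integral_norm_sq_add:
  assumes X: "square_integrable M X" and Y: "square_integrable M Y"
    and orth: "(\<integral>w. X w \<bullet> Y w \<partial>M) = 0"
  shows "(\<integral>w. (norm (X w + Y w))\<^sup>2 \<partial>M) = (\<integral>w. (norm (X w))\<^sup>2 \<partial>M) + (\<integral>w. (norm (Y w))\<^sup>2 \<partial>M)"
proof -
  have "(\<lambda>w. (norm (X w + Y w))\<^sup>2) = (\<lambda>w. (norm (X w))\<^sup>2 + 2 * (X w \<bullet> Y w) + (norm (Y w))\<^sup>2)"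
    unfolding power2_norm_eq_inner by (auto simp: inner_add_left inner_add_right inner_commute)
  then show ?thesis
    using orth X Y square_integrable_inner[OF X Y] by (simp add: square_integrable_def)
qed

lemma (in finite_measure) integral_norm_sq_sum:
  assumes "finite I" and X: "\<And>i. i \<in> I \<Longrightarrow> square_integrable M (X i)"
    and orth: "\<And>i j. \<lbrakk>i \<in> I; j \<in> I; i \<noteq> j\<rbrakk> \<Longrightarrow> (\<integral>w. X i w \<bullet> X j w \<partial>M) = 0"
  shows "(\<integral>w. (norm (\<Sum>i\<in>I. X i w))\<^sup>2 \<partial>M) = (\<Sum>i\<in>I. \<integral>w. (norm (X i w))\<^sup>2 \<partial>M)"
  using assms
proof (induction I)
  case empty
  then show ?case by simp
next
  case (insert i I)
  have "(\<integral>w. X i w \<bullet> (\<Sum>j\<in>I. X j w) \<partial>M) = (\<Sum>j\<in>I. \<integral>w. X i w \<bullet> X j w \<partial>M)"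
    unfolding inner_sum_right using insert.prems
    by (intro Bochner_Integration.integral_sum) (auto intro: square_integrable_inner)
  also have "\<dots> = 0" using insert by (intro sum.neutral) auto
  finally have "(\<integral>w. (norm (X i w + (\<Sum>j\<in>I. X j w)))\<^sup>2 \<partial>M)
      = (\<integral>w. (norm (X i w))\<^sup>2 \<partial>M) + (\<integral>w. (norm (\<Sum>j\<in>I. X j w))\<^sup>2 \<partial>M)"
    using insert.prems by (intro integral_norm_sq_add square_integrable_sum) auto
  then show ?case using insert by auto
qed

lemma norm_sum_sq_le:
  fixes a :: "'i \<Rightarrow> 'a::real_normed_vector"
  assumes "finite I"
  shows "(norm (\<Sum>i\<in>I. a i))\<^sup>2 \<le> real (card I) * (\<Sum>i\<in>I. (norm (a i))\<^sup>2)"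
proof -
  have "(norm (\<Sum>i\<in>I. a i))\<^sup>2 \<le> (\<Sum>i\<in>I. norm (a i))\<^sup>2"
    by (intro power_mono norm_sum) simp
  also have "\<dots> \<le> real (card I) * (\<Sum>i\<in>I. (norm (a i))\<^sup>2)"
    using sum_squared_le_sum_of_squares[of "\<lambda>i. norm (a i)" I] by (simp add: mult.commute)
  finally show ?thesis .
qed

section \<open>Quantization errors and gradient noise\<close>

lemma (in prob_space) measurable_from_indep_algebra:
  assumes "indep_set (sets A) (sets B)" "space A = space M" "space B = space M"
  shows "U \<in> measurable A N \<Longrightarrow> U \<in> measurable M N" "V \<in> measurable B P \<Longrightarrow> V \<in> measurable M P"
proof -
  have "sets A \<subseteq> events" "sets B \<subseteq> events"
    using assms(1) by (auto simp: indep_set_def indep_sets_def split: bool.splits)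
  then show "U \<in> measurable A N \<Longrightarrow> U \<in> measurable M N" "V \<in> measurable B P \<Longrightarrow> V \<in> measurable M P"
    using assms(2,3) by (auto simp: measurable_def)
qed

text \<open>Independence of two information algebras is used through the product form of joint laws, since
  Fubini's theorem then allows the two sources of randomness to be integrated one after the other.
  The variables \<open>U\<close> and \<open>V\<close> may take values in different types: \<open>U\<close> consists of
  vectors, \<open>V\<close> of seeds.\<close>

lemma (in prob_space) indep_algebras_joint_law:
  assumes indep: "indep_set (sets A) (sets B)" and sp: "space A = space M" "space B = space M"
    and U: "U \<in> measurable A N" and V: "V \<in> measurable B P"
  shows "distr M N U \<Otimes>\<^sub>M distr M P V = distr M (N \<Otimes>\<^sub>M P) (\<lambda>w. (U w, V w))"
proof -
  note meas = measurable_from_indep_algebra[OF indep sp]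
  have [measurable]: "U \<in> measurable M N" "V \<in> measurable M P" using meas(1)[OF U] meas(2)[OF V] .
  interpret U: prob_space "distr M N U" by (rule prob_space_distr) simp
  interpret V: prob_space "distr M P V" by (rule prob_space_distr) simp
  show ?thesis
  proof (rule pair_measure_eqI)
    fix S T assume "S \<in> sets (distr M N U)" "T \<in> sets (distr M P V)"
    then have [measurable]: "S \<in> sets N" "T \<in> sets P" by simp_all
    have "U -` S \<inter> space M \<in> sets A" "V -` T \<inter> space M \<in> sets B"
      using measurable_sets[OF U] measurable_sets[OF V] sp by auto
    from indep_setD[OF indep this]
    have "prob ((\<lambda>w. (U w, V w)) -` (S \<times> T) \<inter> space M)
        = prob (U -` S \<inter> space M) * prob (V -` T \<inter> space M)"
      by (simp add: vimage_def Int_def conj_ac)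
    then show "emeasure (distr M N U) S * emeasure (distr M P V) T
        = emeasure (distr M (N \<Otimes>\<^sub>M P) (\<lambda>w. (U w, V w))) (S \<times> T)"
      by (simp add: emeasure_distr emeasure_eq_measure ennreal_mult)
  qed (simp_all add: U.sigma_finite_measure_axioms V.sigma_finite_measure_axioms)
qed

lemma (in prob_space) indep_vars_joint_law:
  assumes indep: "indep_vars (\<lambda>_. Z) X I" and ij: "i \<in> I" "j \<in> I" "i \<noteq> j"
  shows "distr M Z (X i) \<Otimes>\<^sub>M distr M Z (X j) = distr M (Z \<Otimes>\<^sub>M Z) (\<lambda>w. (X i w, X j w))"
proof -
  have X: "X k \<in> measurable M Z" if "k \<in> I" for k
    using indep that by (auto simp: indep_vars_def)
  then have sp: "X k \<in> space M \<rightarrow> space Z" if "k \<in> I" for k using that by (auto simp: measurable_def)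
  have "indep_set (sets (vimage_algebra (space M) (X i) Z)) (sets (vimage_algebra (space M) (X j) Z))"
  proof (rule indep_setI)
    show "sets (vimage_algebra (space M) (X i) Z) \<subseteq> events"
      "sets (vimage_algebra (space M) (X j) Z) \<subseteq> events"
      using measurable_sets[OF X] ij sp by (auto simp: sets_vimage_algebra2)
  next
    fix a b assume "a \<in> sets (vimage_algebra (space M) (X i) Z)"
      "b \<in> sets (vimage_algebra (space M) (X j) Z)"
    then obtain S T where S: "S \<in> sets Z" "a = X i -` S \<inter> space M"
      and T: "T \<in> sets Z" "b = X j -` T \<inter> space M"
      using sp ij by (auto simp: sets_vimage_algebra2)
    have "prob (\<Inter>k\<in>{i, j}. X k -` (if k = i then S else T) \<inter> space M)
        = (\<Prod>k\<in>{i, j}. prob (X k -` (if k = i then S else T) \<inter> space M))"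
      using S T ij by (intro indep_varsD[OF indep]) auto
    then show "prob (a \<inter> b) = prob a * prob b" using S T ij by simp
  qed
  then show ?thesis
    by (rule indep_algebras_joint_law) (use sp ij in \<open>auto intro: measurable_vimage_algebra1\<close>)
qed

lemma (in prob_space) indep_nn_integral:
  assumes indep: "indep_set (sets A) (sets B)" and sp: "space A = space M" "space B = space M"
    and U: "U \<in> measurable A N" and V: "V \<in> measurable B P"
    and [measurable]: "\<phi> \<in> borel_measurable (N \<Otimes>\<^sub>M P)"
  shows "(\<integral>\<^sup>+w. \<phi> (U w, V w) \<partial>M) = (\<integral>\<^sup>+w. (\<integral>\<^sup>+v. \<phi> (U w, v) \<partial>distr M P V) \<partial>M)"
proof -
  note meas = measurable_from_indep_algebra[OF indep sp]
  have [measurable]: "U \<in> measurable M N" "V \<in> measurable M P" using meas(1)[OF U] meas(2)[OF V] .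
  interpret V: prob_space "distr M P V" by (rule prob_space_distr) simp
  have "(\<integral>\<^sup>+w. \<phi> (U w, V w) \<partial>M) = integral\<^sup>N (distr M (N \<Otimes>\<^sub>M P) (\<lambda>w. (U w, V w))) \<phi>"
    by (subst nn_integral_distr) simp_all
  also have "\<dots> = integral\<^sup>N (distr M N U \<Otimes>\<^sub>M distr M P V) \<phi>"
    by (simp add: indep_algebras_joint_law[OF indep sp U V])
  also have "\<dots> = (\<integral>\<^sup>+u. (\<integral>\<^sup>+v. \<phi> (u, v) \<partial>distr M P V) \<partial>distr M N U)"
    by (rule V.nn_integral_fst[symmetric]) measurable
  also have "\<dots> = (\<integral>\<^sup>+w. (\<integral>\<^sup>+v. \<phi> (U w, v) \<partial>distr M P V) \<partial>M)"
    by (rule nn_integral_distr) measurable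
  finally show ?thesis .
qed

lemma (in prob_space) indep_integral_eq_0:
  fixes \<phi> :: "'b \<times> 'c \<Rightarrow> real"
  assumes indep: "indep_set (sets A) (sets B)" and sp: "space A = space M" "space B = space M"
    and U: "U \<in> measurable A N" and V: "V \<in> measurable B P"
    and [measurable]: "\<phi> \<in> borel_measurable (N \<Otimes>\<^sub>M P)"
    and int: "integrable M (\<lambda>w. \<phi> (U w, V w))"
    and zero: "\<And>u. (\<integral>v. \<phi> (u, v) \<partial>distr M P V) = 0"
  shows "(\<integral>w. \<phi> (U w, V w) \<partial>M) = 0"
proof -
  note meas = measurable_from_indep_algebra[OF indep sp]
  have [measurable]: "U \<in> measurable M N" "V \<in> measurable M P" using meas(1)[OF U] meas(2)[OF V] .
  note eq = indep_algebras_joint_law[OF indep sp U V]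
  interpret U: prob_space "distr M N U" by (rule prob_space_distr) simp
  interpret V: prob_space "distr M P V" by (rule prob_space_distr) simp
  interpret UV: pair_sigma_finite "distr M N U" "distr M P V" ..
  have "integrable (distr M N U \<Otimes>\<^sub>M distr M P V) \<phi>"
    unfolding eq using int by (subst integrable_distr_eq) simp_all
  from UV.integral_fst'[OF this] zero
  have "integral\<^sup>L (distr M (N \<Otimes>\<^sub>M P) (\<lambda>w. (U w, V w))) \<phi> = 0" by (simp add: eq)
  then show ?thesis by (subst (asm) integral_distr) simp_all
qed

text \<open>Given the information \<open>A\<close>, the vector \<open>D\<close> is a constant, and the quantization of a
  constant is unbiased.\<close>

lemma (in prob_space) quantization_unbiased:
  assumes q: "quantization_operator \<omega> Z Q"
    and indep: "indep_set (sets A) (sets B)" and sp: "space A = space M" "space B = space M"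
    and s: "s \<in> measurable B Z" and law: "distr M Z s = Z"
    and D: "D \<in> borel_measurable A" and Y: "Y \<in> borel_measurable A"
    and int: "integrable M (\<lambda>w. (Q (s w) (D w) - D w) \<bullet> Y w)"
  shows "(\<integral>w. (Q (s w) (D w) - D w) \<bullet> Y w \<partial>M) = 0"
proof -
  interpret Z: prob_space Z using q by (simp add: quantization_operator_def)
  have [measurable]: "(\<lambda>(z, x). Q z x) \<in> borel_measurable (Z \<Otimes>\<^sub>M borel)"
    using q by (simp add: quantization_operator_def)
  have DY: "(\<lambda>w. (D w, Y w)) \<in> measurable A (borel \<Otimes>\<^sub>M borel)"
    using D Y by measurable
  have "(\<integral>w. (\<lambda>(u, z). (Q z (fst u) - fst u) \<bullet> snd u) ((D w, Y w), s w) \<partial>M) = 0"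
  proof (rule indep_integral_eq_0[OF indep sp DY s])
    show "(\<lambda>(u, z). (Q z (fst u) - fst u) \<bullet> snd u) \<in> borel_measurable ((borel \<Otimes>\<^sub>M borel) \<Otimes>\<^sub>M Z)"
      by measurable
    have "integrable Z (\<lambda>z. Q z d)" "integral\<^sup>L Z (\<lambda>z. Q z d) = d" for d
      using q by (auto simp: quantization_operator_def)
    then show "(\<integral>z. (\<lambda>(u, z). (Q z (fst u) - fst u) \<bullet> snd u) (u, z) \<partial>distr M Z s) = 0" for u
      by (simp add: law Z.prob_space)
  qed (use int in simp)
  then show ?thesis by simp
qed

lemma (in prob_space) quantization_second_moment:
  assumes q: "quantization_operator \<omega> Z Q" and \<omega>: "\<omega> \<ge> 0"
    and indep: "indep_set (sets A) (sets B)" and sp: "space A = space M" "space B = space M"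
    and s: "s \<in> measurable B Z" and law: "distr M Z s = Z"
    and DA: "D \<in> borel_measurable A" and D: "square_integrable M D"
  shows "square_integrable M (\<lambda>w. Q (s w) (D w))"
    and "(\<integral>w. (norm (Q (s w) (D w)))\<^sup>2 \<partial>M) \<le> (\<omega> + 1) * (\<integral>w. (norm (D w))\<^sup>2 \<partial>M)"
proof -
  interpret Z: prob_space Z using q by (simp add: quantization_operator_def)
  have [measurable]: "(\<lambda>(z, x). Q z x) \<in> borel_measurable (Z \<Otimes>\<^sub>M borel)"
    using q by (simp add: quantization_operator_def)
  have [measurable]: "D \<in> borel_measurable M" "s \<in> measurable M Z"
    using D measurable_from_indep_algebra(2)[OF indep sp s] by (simp_all add: square_integrable_def)
  have seed: "(\<integral>\<^sup>+z. ennreal ((norm (Q z d))\<^sup>2) \<partial>Z) \<le> ennreal ((\<omega> + 1) * (norm d)\<^sup>2)" for d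
    using q by (subst nn_integral_eq_integral) (auto simp: quantization_operator_def intro: ennreal_leI)
  have "(\<integral>\<^sup>+w. ennreal ((norm (Q (s w) (D w)))\<^sup>2) \<partial>M)
      = (\<integral>\<^sup>+w. (\<integral>\<^sup>+z. ennreal ((norm (Q z (D w)))\<^sup>2) \<partial>Z) \<partial>M)"
    using indep_nn_integral[OF indep sp DA s, of "\<lambda>(d, z). ennreal ((norm (Q z d))\<^sup>2)"]
    by (simp add: law)
  also have "\<dots> \<le> (\<integral>\<^sup>+w. ennreal ((\<omega> + 1) * (norm (D w))\<^sup>2) \<partial>M)"
    by (intro nn_integral_mono seed)
  also have "\<dots> = ennreal (\<integral>w. (\<omega> + 1) * (norm (D w))\<^sup>2 \<partial>M)"
    using D \<omega> by (intro nn_integral_eq_integral) (auto simp: square_integrable_def)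
  finally have le: "(\<integral>\<^sup>+w. ennreal ((norm (Q (s w) (D w)))\<^sup>2) \<partial>M)
      \<le> ennreal ((\<omega> + 1) * (\<integral>w. (norm (D w))\<^sup>2 \<partial>M))" by simp
  have int: "integrable M (\<lambda>w. (norm (Q (s w) (D w)))\<^sup>2)"
  proof (rule integrableI_bounded)
    show "(\<integral>\<^sup>+w. ennreal (norm ((norm (Q (s w) (D w)))\<^sup>2)) \<partial>M) < \<infinity>"
      using order_le_less_trans[OF le ennreal_less_top] by simp
  qed measurable
  then show "square_integrable M (\<lambda>w. Q (s w) (D w))" by (simp add: square_integrable_def)
  have "0 \<le> (\<omega> + 1) * (\<integral>w. (norm (D w))\<^sup>2 \<partial>M)" using \<omega> by simp
  then show "(\<integral>w. (norm (Q (s w) (D w)))\<^sup>2 \<partial>M) \<le> (\<omega> + 1) * (\<integral>w. (norm (D w))\<^sup>2 \<partial>M)"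
    using le int by (simp add: nn_integral_eq_integral)
qed

text \<open>The error is orthogonal to \<open>D\<close>, so its second moment is the difference of the second
  moments of the quantized vector and of \<open>D\<close>.\<close>

lemma (in prob_space) quantization_error_variance:
  assumes q: "quantization_operator \<omega> Z Q" and \<omega>: "\<omega> \<ge> 0"
    and indep: "indep_set (sets A) (sets B)" and sp: "space A = space M" "space B = space M"
    and s: "s \<in> measurable B Z" and law: "distr M Z s = Z"
    and DA: "D \<in> borel_measurable A" and D: "square_integrable M D"
  shows "(\<integral>w. (norm (Q (s w) (D w) - D w))\<^sup>2 \<partial>M) \<le> \<omega> * (\<integral>w. (norm (D w))\<^sup>2 \<partial>M)"
proof -
  note second = quantization_second_moment[OF assms]
  have err: "square_integrable M (\<lambda>w. Q (s w) (D w) - D w)"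
    using second(1) D by (rule square_integrable_diff)
  have "(\<integral>w. (Q (s w) (D w) - D w) \<bullet> D w \<partial>M) = 0"
    using square_integrable_inner[OF err D]
    by (rule quantization_unbiased[OF q indep sp s law DA DA])
  from integral_norm_sq_add[OF err D this] second(2) show ?thesis
    by (simp add: algebra_simps)
qed

text \<open>For fixed \<open>D\<close> and \<open>E\<close> the two errors depend on independent seeds and have mean
  zero.\<close>

lemma (in prob_space) quantization_errors_uncorrelated:
  assumes q: "quantization_operator \<omega> Z Q"
    and indep: "indep_set (sets A) (sets B)" and sp: "space A = space M" "space B = space M"
    and st: "s \<in> measurable B Z" "t \<in> measurable B Z"
    and law: "distr M (Z \<Otimes>\<^sub>M Z) (\<lambda>w. (s w, t w)) = Z \<Otimes>\<^sub>M Z"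
    and DE: "D \<in> borel_measurable A" "E \<in> borel_measurable A"
    and int: "integrable M (\<lambda>w. (Q (s w) (D w) - D w) \<bullet> (Q (t w) (E w) - E w))"
  shows "(\<integral>w. (Q (s w) (D w) - D w) \<bullet> (Q (t w) (E w) - E w) \<partial>M) = 0"
proof -
  interpret Z: prob_space Z using q by (simp add: quantization_operator_def)
  interpret ZZ: pair_sigma_finite Z Z ..
  have [measurable]: "(\<lambda>(z, x). Q z x) \<in> borel_measurable (Z \<Otimes>\<^sub>M borel)"
    using q by (simp add: quantization_operator_def)
  have mean: "integrable Z (\<lambda>z. Q z d)" "integral\<^sup>L Z (\<lambda>z. Q z d) = d" for d
    using q by (auto simp: quantization_operator_def)
  have DEm: "(\<lambda>w. (D w, E w)) \<in> measurable A (borel \<Otimes>\<^sub>M borel)"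
    using DE by measurable
  have stm: "(\<lambda>w. (s w, t w)) \<in> measurable B (Z \<Otimes>\<^sub>M Z)"
    using st by measurable
  let ?\<phi> = "\<lambda>(u, v). (Q (fst v) (fst u) - fst u) \<bullet> (Q (snd v) (snd u) - snd u)"
  have "(\<integral>w. ?\<phi> ((D w, E w), (s w, t w)) \<partial>M) = 0"
  proof (rule indep_integral_eq_0[OF indep sp DEm stm])
    show "?\<phi> \<in> borel_measurable ((borel \<Otimes>\<^sub>M borel) \<Otimes>\<^sub>M (Z \<Otimes>\<^sub>M Z))" by measurable
    show "(\<integral>v. ?\<phi> (u, v) \<partial>distr M (Z \<Otimes>\<^sub>M Z) (\<lambda>w. (s w, t w))) = 0" for u
    proof (cases "integrable (Z \<Otimes>\<^sub>M Z) (\<lambda>v. ?\<phi> (u, v))")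
      case True
      have "(\<integral>y. ?\<phi> (u, (x, y)) \<partial>Z) = 0" for x
        by (simp add: mean Z.prob_space)
      then show ?thesis using ZZ.integral_fst'[OF True] by (simp add: law)
    next
      case False
      \<comment> \<open>The integral of a function that is not integrable is \<open>0\<close> by convention. This case
        concerns only a null set of \<open>u\<close>.\<close>
      from not_integrable_integral_eq[OF this] show ?thesis unfolding law .
    qed
  qed (use int in simp)
  then show ?thesis by simp
qed

text \<open>The conditional mean is given coordinate by coordinate; in each coordinate the conditional
  expectation may be exchanged against a factor that is measurable with respect to \<open>F\<close>.\<close>

lemma (in prob_space) cond_mean_error_orthogonal:
  fixes X Y V :: "'a \<Rightarrow> 'b::euclidean_space"
  assumes sub: "subalgebra M F" and mean: "has_cond_mean M F X Y"
    and X: "square_integrable M X" and Y: "square_integrable M Y" and V: "square_integrable M V"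
    and VF: "V \<in> borel_measurable F"
  shows "(\<integral>w. V w \<bullet> (X w - Y w) \<partial>M) = 0"
proof -
  interpret finite_measure_subalgebra M F
    using sub by (intro finite_measure_subalgebra.intro finite_measure_subalgebra_axioms.intro)
      unfold_locales
  have comp: "square_integrable M (\<lambda>w. W w \<bullet> b)" if "square_integrable M W" "b \<in> Basis" for W :: "'a \<Rightarrow> 'b" and b
    using that Basis_le_norm[OF that(2)]
    by (intro square_integrable_bound[OF that(1), where r=1]) (auto simp: square_integrable_def)
  have prod: "integrable M (\<lambda>w. (V w \<bullet> b) * (W w \<bullet> b))" if "square_integrable M W" "b \<in> Basis" for W :: "'a \<Rightarrow> 'b" and b
    using square_integrable_inner[OF comp[OF V that(2)] comp[OF that]] by simp
  have eq: "(\<integral>w. (V w \<bullet> b) * (X w \<bullet> b) \<partial>M) = (\<integral>w. (V w \<bullet> b) * (Y w \<bullet> b) \<partial>M)" if b: "b \<in> Basis" for b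
  proof -
    have [measurable]: "X \<in> borel_measurable M" "Y \<in> borel_measurable M" "V \<in> borel_measurable M"
      using X Y V by (simp_all add: square_integrable_def)
    have "(\<integral>w. (V w \<bullet> b) * (X w \<bullet> b) \<partial>M)
        = (\<integral>w. (V w \<bullet> b) * real_cond_exp M F (\<lambda>v. X v \<bullet> b) w \<partial>M)"
      using prod[OF X b] VF by (intro real_cond_exp_intg(2)[symmetric]) auto
    also have "\<dots> = (\<integral>w. (V w \<bullet> b) * (Y w \<bullet> b) \<partial>M)"
    proof (rule integral_cong_AE)
      have "AE w in M. real_cond_exp M F (\<lambda>v. X v \<bullet> b) w = Y w \<bullet> b"
        using mean b by (simp add: has_cond_mean_def)
      then show "AE w in M. (V w \<bullet> b) * real_cond_exp M F (\<lambda>v. X v \<bullet> b) w = (V w \<bullet> b) * (Y w \<bullet> b)"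
        by eventually_elim simp
    qed measurable
    finally show ?thesis .
  qed
  have "(\<integral>w. V w \<bullet> (X w - Y w) \<partial>M)
      = (\<integral>w. (\<Sum>b\<in>Basis. (V w \<bullet> b) * (X w \<bullet> b) - (V w \<bullet> b) * (Y w \<bullet> b)) \<partial>M)"
    by (subst euclidean_inner) (simp add: inner_diff_left right_diff_distrib)
  also have "\<dots> = (\<Sum>b\<in>Basis. (\<integral>w. (V w \<bullet> b) * (X w \<bullet> b) \<partial>M) - (\<integral>w. (V w \<bullet> b) * (Y w \<bullet> b) \<partial>M))"
    using prod X Y by (subst Bochner_Integration.integral_sum) auto
  also have "\<dots> = 0" using eq by simp
  finally show ?thesis .
qed

section \<open>The iterates of DIANA\<close>

text \<open>The second moment of an unbiased estimate of a unit vector is at least \<open>1\<close>.\<close>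

lemma quantization_variance_nonneg:
  fixes Q :: "'z \<Rightarrow> 'a::euclidean_space \<Rightarrow> 'a"
  assumes q: "quantization_operator \<omega> Z Q"
  shows "\<omega> \<ge> 0"
proof -
  interpret Z: prob_space Z using q by (simp add: quantization_operator_def)
  obtain b :: 'a where b: "b \<in> Basis" using nonempty_Basis by blast
  have Q: "integrable Z (\<lambda>z. Q z b)" "(\<integral>z. Q z b \<partial>Z) = b" "integrable Z (\<lambda>z. (norm (Q z b))\<^sup>2)"
    and le: "(\<integral>z. (norm (Q z b))\<^sup>2 \<partial>Z) \<le> (\<omega> + 1) * (norm b)\<^sup>2"
    using q by (auto simp: quantization_operator_def)
  have "(\<integral>z. 2 * (Q z b \<bullet> b) - 1 \<partial>Z) \<le> (\<integral>z. (norm (Q z b))\<^sup>2 \<partial>Z)"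
  proof (rule integral_mono)
    fix z
    have "0 \<le> (Q z b - b) \<bullet> (Q z b - b)" by simp
    then show "2 * (Q z b \<bullet> b) - 1 \<le> (norm (Q z b))\<^sup>2"
      using b by (simp add: power2_norm_eq_inner inner_diff_left inner_diff_right inner_commute inner_Basis)
  qed (use Q in simp_all)
  then show ?thesis using le Q b by (simp add: Z.prob_space inner_Basis)
qed

text \<open>A run for one choice of the step size \<open>\<gamma>\<close>; the conditions that relate \<open>\<alpha>\<close>,
  \<open>\<gamma>\<close> and the weight \<open>c\<close> are hypotheses of the theorems that use them.\<close>

locale diana = prob_space M for M :: "'w measure" +
  fixes Z :: "'z measure"
    and f :: "nat \<Rightarrow> 'a::euclidean_space \<Rightarrow> real"
    and R :: "'a \<Rightarrow> ereal"
    and Q :: "'z \<Rightarrow> 'a \<Rightarrow> 'a"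
    and \<xi> :: "nat \<Rightarrow> nat \<Rightarrow> 'w \<Rightarrow> 'z"
    and g h :: "nat \<Rightarrow> nat \<Rightarrow> 'w \<Rightarrow> 'a"
    and x :: "nat \<Rightarrow> 'w \<Rightarrow> 'a"
    and F :: "nat \<Rightarrow> 'w measure"
    and x0 xs :: 'a and h0 :: "nat \<Rightarrow> 'a"
    and n :: nat and \<sigma> :: "nat \<Rightarrow> real"
    and \<mu> L \<omega> \<alpha> \<gamma> :: real
  assumes n: "n \<ge> 1"
    and strongly_convex: "\<And>i. i \<in> {1..n} \<Longrightarrow> strongly_convex \<mu> (f i)"
    and smooth: "\<And>i. i \<in> {1..n} \<Longrightarrow> smooth L (f i)"
    and regularizer: "closed_convex_regularizer R"
    and minimizer:
      "is_arg_min (\<lambda>y. ereal (1 / real n * (\<Sum>i=1..n. f i y)) + R y) (\<lambda>_. True) xs"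
    and quantization: "quantization_operator \<omega> Z Q"
    and run: "diana_run M n \<alpha> \<gamma> R Q \<xi> g x0 h0 x h"
    and history: "diana_history M n F Q \<xi> g h"
    and gradient_mean:
      "\<And>i k. i \<in> {1..n} \<Longrightarrow> has_cond_mean M (F k) (g i k) (\<lambda>w. grad (f i) (x k w))"
    and fresh: "\<And>k. fresh_seeds M (history_with_gradients M n F g k) Z (\<lambda>i. \<xi> i k) {1..n}"
    and noise_integrable:
      "\<And>i k. i \<in> {1..n} \<Longrightarrow> integrable M (\<lambda>w. (norm (g i k w - grad (f i) (x k w)))\<^sup>2)"
    and noise_bound: "\<And>i k. i \<in> {1..n} \<Longrightarrow>
        integral\<^sup>L M (\<lambda>w. (norm (g i k w - grad (f i) (x k w)))\<^sup>2) \<le> (\<sigma> i)\<^sup>2"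
    and \<gamma>_pos: "\<gamma> > 0"
begin

definition gopt :: "nat \<Rightarrow> 'a" where
  "gopt i = grad (f i) xs"

definition gdiff :: "nat \<Rightarrow> nat \<Rightarrow> 'w \<Rightarrow> 'a" where
  "gdiff i k w = grad (f i) (x k w) - gopt i"

definition noise :: "nat \<Rightarrow> nat \<Rightarrow> 'w \<Rightarrow> 'a" where
  "noise i k w = g i k w - grad (f i) (x k w)"

definition shift_diff :: "nat \<Rightarrow> nat \<Rightarrow> 'w \<Rightarrow> 'a" where
  "shift_diff i k w = h i k w - gopt i"

definition err :: "nat \<Rightarrow> nat \<Rightarrow> 'w \<Rightarrow> 'a" where
  "err i k w = quantized_diff Q \<xi> g h i k w - (g i k w - h i k w)"

lemma n_pos: "real n > 0" using n by simp

lemma \<mu>_pos: "\<mu> > 0" and L_pos: "L > 0"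
  using strongly_convex[of 1] smooth[of 1] n by (auto simp: strongly_convex_def smooth_def)

lemma \<mu>_le_L: "\<mu> \<le> L"
proof -
  obtain b :: 'a where "b \<in> Basis" using nonempty_Basis by blast
  then have "b \<noteq> 0" by auto
  then show ?thesis
    using curvature_le[OF strongly_convex[of 1] smooth[of 1], of b 0] n by simp
qed

lemma \<omega>_nonneg: "\<omega> \<ge> 0"
  using quantization by (rule quantization_variance_nonneg)

text \<open>The vector in the conclusion is the gradient at \<open>xs\<close> of the average of the \<open>f i\<close>. The
  minimizer \<open>xs\<close> has a finite value of \<open>R\<close> because \<open>R\<close> is finite somewhere.\<close>

lemma minimizer_subgradient:
  obtains rs where "R xs \<le> ereal rs"
    "\<And>y r. R y \<le> ereal r \<Longrightarrow> rs - ((1 / real n) *\<^sub>R (\<Sum>i=1..n. gopt i)) \<bullet> (y - xs) \<le> r"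
proof -
  define \<Phi> where "\<Phi> = (\<lambda>y. 1 / real n * (\<Sum>i=1..n. f i y))"
  have min: "ereal (\<Phi> xs) + R xs \<le> ereal (\<Phi> y) + R y" for y
    using minimizer by (simp add: is_arg_min_linorder \<Phi>_def)
  have nm: "R y \<noteq> -\<infinity>" for y using regularizer by (simp add: closed_convex_regularizer_def)
  obtain y0 where "R y0 \<noteq> \<infinity>" using regularizer by (auto simp: closed_convex_regularizer_def)
  then obtain rs where rs: "R xs = ereal rs"
    using min[of y0] nm[of xs] nm[of y0] by (cases "R xs"; cases "R y0") auto
  have upper: "\<Phi> y \<le> \<Phi> xs + ((1 / real n) *\<^sub>R (\<Sum>i=1..n. gopt i)) \<bullet> (y - xs)
      + L / 2 * (norm (y - xs))\<^sup>2" for y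
  proof -
    have "(\<Sum>i=1..n. f i y)
        \<le> (\<Sum>i=1..n. f i xs + gopt i \<bullet> (y - xs) + L / 2 * (norm (y - xs))\<^sup>2)"
      using smooth by (intro sum_mono) (auto simp: smooth_def gopt_def norm_minus_commute)
    also have "\<dots> = (\<Sum>i=1..n. f i xs) + (\<Sum>i=1..n. gopt i) \<bullet> (y - xs)
        + real n * (L / 2 * (norm (y - xs))\<^sup>2)"
      by (simp add: sum.distrib inner_sum_left)
    finally have "\<Phi> y \<le> 1 / real n * ((\<Sum>i=1..n. f i xs) + (\<Sum>i=1..n. gopt i) \<bullet> (y - xs)
        + real n * (L / 2 * (norm (y - xs))\<^sup>2))"
      unfolding \<Phi>_def by (rule mult_left_mono) simp
    also have "\<dots> = \<Phi> xs + ((1 / real n) *\<^sub>R (\<Sum>i=1..n. gopt i)) \<bullet> (y - xs)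
        + L / 2 * (norm (y - xs))\<^sup>2"
      using n_pos unfolding \<Phi>_def by (simp add: distrib_left)
    finally show ?thesis .
  qed
  have least: "ereal (\<Phi> xs) + ereal rs \<le> ereal (\<Phi> y) + R y" for y
    using min[of y] by (simp add: rs)
  show ?thesis
  proof (rule that)
    show "R xs \<le> ereal rs" by (simp add: rs)
    then show "rs - ((1 / real n) *\<^sub>R (\<Sum>i=1..n. gopt i)) \<bullet> (y - xs) \<le> r"
      if "R y \<le> ereal r" for y r
      using that by (rule regularizer_subgradient_at_minimizer[OF regularizer upper least])
  qed
qed

lemma prox_measurable: "prox \<gamma> R \<in> borel_measurable borel"
  using minimizer_subgradient prox_borel_measurable[OF regularizer \<gamma>_pos] by metis

lemma prox_towards_minimizer:
  "norm (prox \<gamma> R a - xs) \<le> norm (a - (xs - \<gamma> *\<^sub>R ((1 / real n) *\<^sub>R (\<Sum>i=1..n. gopt i))))"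
  using minimizer_subgradient prox_nonexpansive(2)[OF regularizer \<gamma>_pos] by metis

lemma run_h: "w \<in> space M \<Longrightarrow> i \<in> {1..n} \<Longrightarrow>
    h i (Suc k) w = h i k w + \<alpha> *\<^sub>R quantized_diff Q \<xi> g h i k w"
  and run_x: "w \<in> space M \<Longrightarrow> x (Suc k) w = prox \<gamma> R (x k w - \<gamma> *\<^sub>R
      ((1 / real n) *\<^sub>R (\<Sum>i=1..n. h i k w + quantized_diff Q \<xi> g h i k w)))"
  and run_0: "w \<in> space M \<Longrightarrow> x 0 w = x0" "w \<in> space M \<Longrightarrow> i \<in> {1..n} \<Longrightarrow> h i 0 w = h0 i"
  using run by (simp_all add: diana_run_def)

lemma history_subalgebra: "subalgebra M (F k)"
  using history by (simp add: diana_history_def)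

lemma history_space: "space (F k) = space M"
  using history_subalgebra by (simp add: subalgebra_def)

lemma history_Suc: "X \<in> measurable (F k) N \<Longrightarrow> X \<in> measurable (F (Suc k)) N"
  using history unfolding diana_history_def filtration_def
  by (intro measurable_from_subalg[of "F (Suc k)" "F k"]) (simp_all add: subalgebra_def history_space)

lemma history_M: "X \<in> measurable (F k) N \<Longrightarrow> X \<in> measurable M N"
  using history_subalgebra by (rule measurable_from_subalg)

lemma quantized_diff_measurable:
  "i \<in> {1..n} \<Longrightarrow> quantized_diff Q \<xi> g h i k \<in> borel_measurable (F (Suc k))"
  using history by (simp add: diana_history_def)

lemma h_measurable: "i \<in> {1..n} \<Longrightarrow> h i k \<in> borel_measurable (F k)"
proof (induction k)
  case 0
  have "h i 0 \<in> borel_measurable (F 0) \<longleftrightarrow> (\<lambda>_. h0 i) \<in> borel_measurable (F 0)"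
    using 0 by (intro measurable_cong) (simp add: history_space run_0)
  then show ?case by simp
next
  case (Suc k)
  have [measurable]: "h i k \<in> borel_measurable (F (Suc k))"
    "quantized_diff Q \<xi> g h i k \<in> borel_measurable (F (Suc k))"
    using Suc history_Suc quantized_diff_measurable by auto
  have "h i (Suc k) \<in> borel_measurable (F (Suc k)) \<longleftrightarrow>
      (\<lambda>w. h i k w + \<alpha> *\<^sub>R quantized_diff Q \<xi> g h i k w) \<in> borel_measurable (F (Suc k))"
    using Suc.prems by (intro measurable_cong) (simp add: history_space run_h)
  then show ?case by simp
qed

lemma x_measurable: "x k \<in> borel_measurable (F k)"
proof (induction k)
  case 0
  have "x 0 \<in> borel_measurable (F 0) \<longleftrightarrow> (\<lambda>_. x0) \<in> borel_measurable (F 0)"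
    by (intro measurable_cong) (simp add: history_space run_0)
  then show ?case by simp
next
  case (Suc k)
  have [measurable]: "x k \<in> borel_measurable (F (Suc k))"
    using Suc by (rule history_Suc)
  have [measurable]: "h i k \<in> borel_measurable (F (Suc k))"
    "quantized_diff Q \<xi> g h i k \<in> borel_measurable (F (Suc k))" if "i \<in> {1..n}" for i
    using that history_Suc[OF h_measurable] quantized_diff_measurable by auto
  have "x (Suc k) \<in> borel_measurable (F (Suc k)) \<longleftrightarrow>
      (\<lambda>w. prox \<gamma> R (x k w - \<gamma> *\<^sub>R
        ((1 / real n) *\<^sub>R (\<Sum>i=1..n. h i k w + quantized_diff Q \<xi> g h i k w))))
      \<in> borel_measurable (F (Suc k))"
    by (intro measurable_cong) (simp add: history_space run_x)
  moreover have "\<dots>"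
    by (rule measurable_compose[OF _ prox_measurable]) measurable
  ultimately show ?case by simp
qed

lemma grad_measurable:
  assumes "i \<in> {1..n}"
  shows "(\<lambda>w. grad (f i) (x k w)) \<in> borel_measurable (F k)"
proof -
  have "L-lipschitz_on UNIV (grad (f i))"
    using gradient_lipschitz[OF strongly_convex smooth, OF assms assms] L_pos
    by (intro lipschitz_onI) (auto simp: dist_norm)
  then have "grad (f i) \<in> borel_measurable borel"
    by (intro borel_measurable_continuous_onI lipschitz_on_continuous_on)
  with x_measurable show ?thesis by (rule measurable_compose)
qed

text \<open>The seeds of iteration \<open>k\<close> are independent of \<open>info k\<close>; they generate \<open>seed_algebra k\<close>.\<close>

abbreviation info :: "nat \<Rightarrow> 'w measure" where
  "info k \<equiv> history_with_gradients M n F g k"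

abbreviation seed_algebra :: "nat \<Rightarrow> 'w measure" where
  "seed_algebra k \<equiv>
     vimage_algebra (space M) (\<lambda>w. \<lambda>i\<in>{1..n}. \<xi> i k w) (Pi\<^sub>M {1..n} (\<lambda>_. Z))"

lemma info_generators:
  "sets (F k) \<union> (\<Union>i\<in>{1..n}. {g i k -` A \<inter> space M | A. A \<in> sets borel}) \<subseteq> Pow (space M)"
  using sets.space_closed[of "F k"] history_space[of k] by auto

lemma info_space: "space (info k) = space M"
  unfolding history_with_gradients_def by (rule space_measure_of[OF info_generators])

lemma info_sets: "sets (F k) \<union> (\<Union>i\<in>{1..n}. {g i k -` A \<inter> space M | A. A \<in> sets borel}) \<subseteq> sets (info k)"
  unfolding history_with_gradients_def sets_measure_of[OF info_generators] by blast

lemma history_info: "X \<in> measurable (F k) N \<Longrightarrow> X \<in> measurable (info k) N"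
  using info_sets[of k]
  by (intro measurable_from_subalg[of "info k" "F k"]) (auto simp: subalgebra_def history_space info_space)

lemma g_info: "i \<in> {1..n} \<Longrightarrow> g i k \<in> borel_measurable (info k)"
proof (rule measurableI)
  fix A :: "'a set" assume "i \<in> {1..n}" "A \<in> sets borel"
  then have "g i k -` A \<inter> space M \<in> (\<Union>i\<in>{1..n}. {g i k -` A \<inter> space M | A. A \<in> sets borel})"
    by blast
  then show "g i k -` A \<inter> space (info k) \<in> sets (info k)"
    using info_sets[of k] by (auto simp only: info_space)
qed simp

lemma seeds_indep: "indep_set (sets (info k)) (sets (seed_algebra k))"
  using fresh[of k] by (simp add: fresh_seeds_def)

lemma seed_law: "i \<in> {1..n} \<Longrightarrow> distr M Z (\<xi> i k) = Z"
  and seed_random: "i \<in> {1..n} \<Longrightarrow> \<xi> i k \<in> measurable M Z"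
  using fresh[of k] by (simp_all add: fresh_seeds_def)

lemma seed_pair_law:
  assumes "i \<in> {1..n}" "j \<in> {1..n}" "i \<noteq> j"
  shows "distr M (Z \<Otimes>\<^sub>M Z) (\<lambda>w. (\<xi> i k w, \<xi> j k w)) = Z \<Otimes>\<^sub>M Z"
  using fresh[of k] indep_vars_joint_law[of Z "\<lambda>i. \<xi> i k" "{1..n}", OF _ assms] assms
  by (simp add: fresh_seeds_def)

lemma seed_measurable: "i \<in> {1..n} \<Longrightarrow> \<xi> i k \<in> measurable (seed_algebra k) Z"
proof -
  assume i: "i \<in> {1..n}"
  have "(\<lambda>w. \<lambda>i\<in>{1..n}. \<xi> i k w) \<in> space M \<rightarrow> space (Pi\<^sub>M {1..n} (\<lambda>_. Z))"
    using measurable_space[OF seed_random[of _ k]] by (auto simp: space_PiM)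
  from measurable_vimage_algebra1[OF this] measurable_component_singleton[OF i]
  have "(\<lambda>w. (\<lambda>i\<in>{1..n}. \<xi> i k w) i) \<in> measurable (seed_algebra k) Z"
    by (rule measurable_compose)
  then show ?thesis using i by simp
qed

lemma noise_square_integrable:
  assumes i: "i \<in> {1..n}"
  shows "square_integrable M (noise i k)"
proof -
  have "g i k \<in> borel_measurable M"
    using gradient_mean[OF i, of k] by (auto simp: has_cond_mean_def)
  then have "noise i k \<in> borel_measurable M"
    using history_M[OF grad_measurable[OF i, of k]] by (simp add: noise_def[abs_def])
  then show ?thesis using noise_integrable[OF i] by (simp add: square_integrable_def noise_def)
qed

end

text \<open>One iteration. Square integrability of the current iterates is what makes the expected values
  below meaningful; it propagates from iteration to iteration.\<close>

locale diana_iteration = diana +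
  fixes k :: nat
  assumes x_sq: "square_integrable M (x k)"
    and h_sq: "\<And>i. i \<in> {1..n} \<Longrightarrow> square_integrable M (h i k)"
begin

lemma dist_sq: "square_integrable M (\<lambda>w. x k w - xs)"
  using x_sq square_integrable_const by (rule square_integrable_diff)

lemma shift_diff_sq: "i \<in> {1..n} \<Longrightarrow> square_integrable M (shift_diff i k)"
  unfolding shift_diff_def[abs_def] using h_sq square_integrable_const by (intro square_integrable_diff)

lemma gdiff_sq:
  assumes i: "i \<in> {1..n}"
  shows "square_integrable M (gdiff i k)"
proof (rule square_integrable_bound[OF dist_sq])
  show "gdiff i k \<in> borel_measurable M"
    using history_M[OF grad_measurable[OF i, of k]] by (simp add: gdiff_def[abs_def])
  show "norm (gdiff i k w) \<le> L * norm (x k w - xs)" for w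
    unfolding gdiff_def gopt_def using gradient_lipschitz[OF strongly_convex smooth, OF i i] .
qed

lemma g_eq: "g i k w = (gdiff i k w + noise i k w) + gopt i"
  by (simp add: gdiff_def noise_def)

lemma diff_eq: "g i k w - h i k w = (gdiff i k w - shift_diff i k w) + noise i k w"
  by (simp add: gdiff_def noise_def shift_diff_def)

lemma diff_sq: "i \<in> {1..n} \<Longrightarrow> square_integrable M (\<lambda>w. g i k w - h i k w)"
  unfolding diff_eq
  by (intro square_integrable_add square_integrable_diff gdiff_sq shift_diff_sq noise_square_integrable)

lemma noise_orthogonal:
  assumes i: "i \<in> {1..n}" and V: "square_integrable M V" "V \<in> borel_measurable (F k)"
  shows "(\<integral>w. V w \<bullet> noise i k w \<partial>M) = 0"
proof -
  have "square_integrable M (\<lambda>w. (gdiff i k w + noise i k w) + gopt i)"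
    using i by (intro square_integrable_add square_integrable_const gdiff_sq noise_square_integrable)
  then have X: "square_integrable M (g i k)" by (simp add: g_eq[symmetric])
  have "square_integrable M (\<lambda>w. gdiff i k w + gopt i)"
    using i by (intro square_integrable_add square_integrable_const gdiff_sq)
  then have Y: "square_integrable M (\<lambda>w. grad (f i) (x k w))" by (simp add: gdiff_def)
  show ?thesis unfolding noise_def
    by (rule cond_mean_error_orthogonal[OF history_subalgebra gradient_mean[OF i] X Y V])
qed

lemma diff_info: "i \<in> {1..n} \<Longrightarrow> (\<lambda>w. g i k w - h i k w) \<in> borel_measurable (info k)"
  using g_info history_info[OF h_measurable] by (intro borel_measurable_diff)

lemma quantized_diff_eq: "quantized_diff Q \<xi> g h i k w = (g i k w - h i k w) + err i k w"
  by (simp add: err_def)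

lemma err_sq:
  assumes i: "i \<in> {1..n}"
  shows "square_integrable M (err i k)"
proof -
  have "square_integrable M (\<lambda>w. Q (\<xi> i k w) (g i k w - h i k w))"
    using i by (intro quantization_second_moment(1)[OF quantization \<omega>_nonneg seeds_indep info_space _
          seed_measurable seed_law diff_info diff_sq]) simp_all
  from square_integrable_diff[OF this diff_sq[OF i]] show ?thesis
    by (simp add: err_def[abs_def] quantized_diff_def)
qed

lemma err_variance:
  assumes i: "i \<in> {1..n}"
  shows "(\<integral>w. (norm (err i k w))\<^sup>2 \<partial>M) \<le> \<omega> * (\<integral>w. (norm (g i k w - h i k w))\<^sup>2 \<partial>M)"
  unfolding err_def quantized_diff_def
  using quantization_error_variance[OF quantization \<omega>_nonneg seeds_indep info_space _
      seed_measurable seed_law diff_info diff_sq, OF _ i i i i] by simp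

lemma err_orthogonal:
  assumes i: "i \<in> {1..n}" and Y: "square_integrable M Y" "Y \<in> borel_measurable (info k)"
  shows "(\<integral>w. Y w \<bullet> err i k w \<partial>M) = 0"
proof -
  have "(\<integral>w. err i k w \<bullet> Y w \<partial>M) = 0"
    using square_integrable_inner[OF err_sq[OF i] Y(1)] unfolding err_def quantized_diff_def
    by (intro quantization_unbiased[OF quantization seeds_indep info_space _
          seed_measurable[OF i] seed_law[OF i] diff_info[OF i] Y(2)]) simp_all
  then show ?thesis by (simp add: inner_commute)
qed

lemma err_uncorrelated:
  assumes ij: "i \<in> {1..n}" "j \<in> {1..n}" "i \<noteq> j"
  shows "(\<integral>w. err i k w \<bullet> err j k w \<partial>M) = 0"
  using square_integrable_inner[OF err_sq[OF ij(1)] err_sq[OF ij(2)]] ij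
  unfolding err_def quantized_diff_def
  by (intro quantization_errors_uncorrelated[OF quantization seeds_indep info_space _
        seed_measurable seed_measurable seed_pair_law diff_info diff_info]) simp_all

text \<open>A step along the exact gradients. The distance term of co-coercivity pays for the
  contraction factor \<open>1 - \<gamma> \<mu>\<close>, since \<open>2 \<mu> L / (\<mu> + L) \<ge> \<mu>\<close>; its gradient term
  is kept, because the quantization errors are to be paid from it.\<close>

lemma gradient_step_contracts:
  "(norm ((x k w - xs) - (\<gamma> / real n) *\<^sub>R (\<Sum>i=1..n. gdiff i k w)))\<^sup>2
    \<le> (1 - \<gamma> * \<mu>) * (norm (x k w - xs))\<^sup>2
      + (\<gamma>\<^sup>2 / real n - 2 * \<gamma> / (real n * (\<mu> + L))) * (\<Sum>i=1..n. (norm (gdiff i k w))\<^sup>2)"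
proof -
  define d where "d = x k w - xs"
  define S where "S = (\<Sum>i=1..n. (norm (gdiff i k w))\<^sup>2)"
  have \<mu>L: "\<mu> + L > 0" using \<mu>_pos L_pos by simp
  have co: "(1 / (\<mu> + L)) * (norm (gdiff i k w))\<^sup>2 + \<mu> / 2 * (norm d)\<^sup>2 \<le> d \<bullet> gdiff i k w"
    if i: "i \<in> {1..n}" for i
  proof -
    have "\<mu> / 2 * (\<mu> + L) \<le> \<mu> * L" using \<mu>_le_L \<mu>_pos by (simp add: algebra_simps)
    then have "\<mu> / 2 * (\<mu> + L) * (norm d)\<^sup>2 \<le> \<mu> * L * (norm d)\<^sup>2" by (intro mult_right_mono) auto
    moreover have "(norm (gdiff i k w))\<^sup>2 + \<mu> * L * (norm d)\<^sup>2 \<le> (\<mu> + L) * (d \<bullet> gdiff i k w)"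
      using gradient_cocoercive[OF strongly_convex[OF i] smooth[OF i], of "x k w" xs]
      by (simp add: gdiff_def gopt_def d_def inner_commute)
    moreover have "(\<mu> + L) * ((1 / (\<mu> + L)) * (norm (gdiff i k w))\<^sup>2 + \<mu> / 2 * (norm d)\<^sup>2)
        = (norm (gdiff i k w))\<^sup>2 + \<mu> / 2 * (\<mu> + L) * (norm d)\<^sup>2"
      using \<mu>L by (simp add: distrib_left[of "\<mu> + L"])
    ultimately have "(\<mu> + L) * ((1 / (\<mu> + L)) * (norm (gdiff i k w))\<^sup>2 + \<mu> / 2 * (norm d)\<^sup>2)
        \<le> (\<mu> + L) * (d \<bullet> gdiff i k w)"
      by linarith
    then show ?thesis using \<mu>L by simp
  qed
  have "(1 / (\<mu> + L)) * S + real n * (\<mu> / 2 * (norm d)\<^sup>2)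
      = (\<Sum>i=1..n. (1 / (\<mu> + L)) * (norm (gdiff i k w))\<^sup>2 + \<mu> / 2 * (norm d)\<^sup>2)"
    by (simp add: S_def sum.distrib sum_distrib_left)
  also have "\<dots> \<le> (\<Sum>i=1..n. d \<bullet> gdiff i k w)" using co by (intro sum_mono)
  also have "\<dots> = d \<bullet> (\<Sum>i=1..n. gdiff i k w)" by (simp add: inner_sum_right)
  finally have "2 * (\<gamma> / real n) * ((1 / (\<mu> + L)) * S + real n * (\<mu> / 2 * (norm d)\<^sup>2))
      \<le> 2 * (\<gamma> / real n) * (d \<bullet> (\<Sum>i=1..n. gdiff i k w))"
    using \<gamma>_pos by (intro mult_left_mono) auto
  then have cross: "2 * \<gamma> / (real n * (\<mu> + L)) * S + \<gamma> * \<mu> * (norm d)\<^sup>2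
      \<le> 2 * (\<gamma> / real n) * (d \<bullet> (\<Sum>i=1..n. gdiff i k w))"
    using n_pos by (simp add: distrib_left)
  have "(\<gamma> / real n)\<^sup>2 * (norm (\<Sum>i=1..n. gdiff i k w))\<^sup>2 \<le> (\<gamma> / real n)\<^sup>2 * (real n * S)"
    using norm_sum_sq_le[of "{1..n}" "\<lambda>i. gdiff i k w"] by (intro mult_left_mono) (simp_all add: S_def)
  also have "\<dots> = \<gamma>\<^sup>2 / real n * S" using n_pos by (simp add: power2_eq_square)
  finally have quad: "(\<gamma> / real n)\<^sup>2 * (norm (\<Sum>i=1..n. gdiff i k w))\<^sup>2 \<le> \<gamma>\<^sup>2 / real n * S" .
  have "(norm (d - (\<gamma> / real n) *\<^sub>R (\<Sum>i=1..n. gdiff i k w)))\<^sup>2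
      = (norm d)\<^sup>2 - 2 * (\<gamma> / real n) * (d \<bullet> (\<Sum>i=1..n. gdiff i k w))
        + (\<gamma> / real n)\<^sup>2 * (norm (\<Sum>i=1..n. gdiff i k w))\<^sup>2"
    unfolding power2_norm_eq_inner
    by (simp add: inner_diff_left inner_diff_right inner_commute power2_eq_square)
  with cross quad show ?thesis unfolding d_def[symmetric] S_def[symmetric]
    by (simp add: left_diff_distrib)
qed

abbreviation "dist2 \<equiv> (\<integral>w. (norm (x k w - xs))\<^sup>2 \<partial>M)"
abbreviation "shift_diff2 i \<equiv> (\<integral>w. (norm (shift_diff i k w))\<^sup>2 \<partial>M)"
abbreviation "gdiff2 i \<equiv> (\<integral>w. (norm (gdiff i k w))\<^sup>2 \<partial>M)"

text \<open>The quantized vector compares a gradient with the shift \<open>h i k\<close>; both are compared with the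
  gradient at \<open>xs\<close>, which makes quantization cheap near the solution, up to the gradient noise.\<close>

lemma diff_second_moment:
  assumes i: "i \<in> {1..n}"
  shows "(\<integral>w. (norm (g i k w - h i k w))\<^sup>2 \<partial>M) \<le> 2 * gdiff2 i + 2 * shift_diff2 i + (\<sigma> i)\<^sup>2"
proof -
  have F: "(\<lambda>w. gdiff i k w - shift_diff i k w) \<in> borel_measurable (F k)"
    using grad_measurable[OF i] h_measurable[OF i]
    unfolding gdiff_def[abs_def] shift_diff_def[abs_def] by measurable
  have sq: "square_integrable M (\<lambda>w. gdiff i k w - shift_diff i k w)"
    by (intro square_integrable_diff gdiff_sq shift_diff_sq i)
  have "(\<integral>w. (norm (g i k w - h i k w))\<^sup>2 \<partial>M)
      = (\<integral>w. (norm (gdiff i k w - shift_diff i k w))\<^sup>2 \<partial>M) + (\<integral>w. (norm (noise i k w))\<^sup>2 \<partial>M)"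
    unfolding diff_eq
    by (intro integral_norm_sq_add sq noise_square_integrable noise_orthogonal F i)
  moreover have "(\<integral>w. (norm (gdiff i k w - shift_diff i k w))\<^sup>2 \<partial>M)
      \<le> (\<integral>w. 2 * (norm (gdiff i k w))\<^sup>2 + 2 * (norm (shift_diff i k w))\<^sup>2 \<partial>M)"
  proof (rule integral_mono)
    fix w
    have "0 \<le> (gdiff i k w + shift_diff i k w) \<bullet> (gdiff i k w + shift_diff i k w)" by simp
    then show "(norm (gdiff i k w - shift_diff i k w))\<^sup>2
        \<le> 2 * (norm (gdiff i k w))\<^sup>2 + 2 * (norm (shift_diff i k w))\<^sup>2"
      unfolding power2_norm_eq_inner
      by (simp add: inner_diff_left inner_diff_right inner_add_left inner_add_right inner_commute)
  qed (use sq gdiff_sq[OF i] shift_diff_sq[OF i] in \<open>simp_all add: square_integrable_norm_sq\<close>)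
  moreover have "\<dots> = 2 * gdiff2 i + 2 * shift_diff2 i"
    using gdiff_sq[OF i] shift_diff_sq[OF i] by (simp add: square_integrable_norm_sq)
  ultimately show ?thesis
    using noise_bound[OF i, of k] by (simp add: noise_def)
qed

text \<open>Nonexpansiveness removes the proximal operator. What remains is a sum of three mutually
  orthogonal terms: the exact gradient step \<open>A\<close>, which is known from the history; the gradient
  noise \<open>N\<close>, which has conditional mean zero given the history; and the quantization error \<open>W\<close>,
  which has mean zero given history and gradients. The noise of the workers is averaged by
  convexity of the squared norm. The quantization errors are uncorrelated across workers, which gains
  a factor \<open>1 / n\<close>.\<close>

lemma x_step:
  shows "square_integrable M (x (Suc k))"
    and "(\<integral>w. (norm (x (Suc k) w - xs))\<^sup>2 \<partial>M)
      \<le> (1 - \<gamma> * \<mu>) * dist2 + (\<gamma>\<^sup>2 / real n - 2 * \<gamma> / (real n * (\<mu> + L))) * (\<Sum>i=1..n. gdiff2 i)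
        + \<gamma>\<^sup>2 / real n * (\<Sum>i=1..n. (\<sigma> i)\<^sup>2)
        + \<gamma>\<^sup>2 * \<omega> / (real n)\<^sup>2 * (\<Sum>i=1..n. 2 * gdiff2 i + 2 * shift_diff2 i + (\<sigma> i)\<^sup>2)"
proof -
  define r where "r = - (\<gamma> / real n)"
  define A where "A = (\<lambda>w. (x k w - xs) - (\<gamma> / real n) *\<^sub>R (\<Sum>i=1..n. gdiff i k w))"
  define N where "N = (\<lambda>w. \<Sum>i=1..n. r *\<^sub>R noise i k w)"
  define W where "W = (\<lambda>w. \<Sum>i=1..n. r *\<^sub>R err i k w)"
  have A_sq: "square_integrable M A" unfolding A_def
    by (intro square_integrable_diff[OF dist_sq] square_integrable_scaleR square_integrable_sum gdiff_sq)
  have N_sq: "square_integrable M N" unfolding N_def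
    by (intro square_integrable_scaleR square_integrable_sum noise_square_integrable)
  have W_sq: "square_integrable M W" unfolding W_def
    by (intro square_integrable_scaleR square_integrable_sum err_sq)
  have AN_sq: "square_integrable M (\<lambda>w. A w + N w)" using A_sq N_sq by (rule square_integrable_add)
  have ANW_sq: "square_integrable M (\<lambda>w. (A w + N w) + W w)"
    using AN_sq W_sq by (rule square_integrable_add)
  have bound: "norm (x (Suc k) w - xs) \<le> norm ((A w + N w) + W w)" if w: "w \<in> space M" for w
  proof -
    have "(x k w - \<gamma> *\<^sub>R ((1 / real n) *\<^sub>R (\<Sum>i=1..n. h i k w + quantized_diff Q \<xi> g h i k w)))
          - (xs - \<gamma> *\<^sub>R ((1 / real n) *\<^sub>R (\<Sum>i=1..n. gopt i)))
        = (x k w - xs) - (\<gamma> / real n) *\<^sub>R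
            (\<Sum>i=1..n. (h i k w + quantized_diff Q \<xi> g h i k w) - gopt i)"
      by (simp add: sum_subtractf scaleR_diff_right)
    also have "(\<Sum>i=1..n. (h i k w + quantized_diff Q \<xi> g h i k w) - gopt i)
        = (\<Sum>i=1..n. gdiff i k w + noise i k w + err i k w)"
      by (intro sum.cong) (simp_all add: quantized_diff_eq gdiff_def noise_def)
    also have "(x k w - xs) - (\<gamma> / real n) *\<^sub>R \<dots> = (A w + N w) + W w"
      by (simp add: A_def N_def W_def r_def sum.distrib scaleR_sum_right scaleR_add_right sum_negf)
    finally show ?thesis
      using prox_towards_minimizer[of "x k w - \<gamma> *\<^sub>R
        ((1 / real n) *\<^sub>R (\<Sum>i=1..n. h i k w + quantized_diff Q \<xi> g h i k w))"]
      by (simp only: run_x[OF w])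
  qed
  have x_meas: "x (Suc k) \<in> borel_measurable M" using history_M[OF x_measurable] .
  have "square_integrable M (\<lambda>w. x (Suc k) w - xs)"
    using bound x_meas by (intro square_integrable_bound[OF ANW_sq, where r=1]) simp_all
  note d_sq = this
  show "square_integrable M (x (Suc k))"
    using square_integrable_add[OF d_sq square_integrable_const[of xs]] by simp
  have "(\<integral>w. (norm (x (Suc k) w - xs))\<^sup>2 \<partial>M) \<le> (\<integral>w. (norm ((A w + N w) + W w))\<^sup>2 \<partial>M)"
    using bound square_integrable_norm_sq[OF d_sq] square_integrable_norm_sq[OF ANW_sq]
    by (intro integral_mono) (auto intro: power_mono)
  also have "\<dots> = (\<integral>w. (norm (A w + N w))\<^sup>2 \<partial>M) + (\<integral>w. (norm (W w))\<^sup>2 \<partial>M)"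
  proof (rule integral_norm_sq_add[OF AN_sq W_sq])
    have AN_info: "(\<lambda>w. A w + N w) \<in> borel_measurable (info k)"
    proof -
      have [measurable]: "x k \<in> borel_measurable (info k)" using history_info[OF x_measurable] .
      have [measurable]: "(\<lambda>w. grad (f i) (x k w)) \<in> borel_measurable (info k)"
        "g i k \<in> borel_measurable (info k)" if "i \<in> {1..n}" for i
        using that history_info[OF grad_measurable] g_info by auto
      show ?thesis unfolding A_def N_def gdiff_def noise_def by measurable
    qed
    have "(\<integral>w. (A w + N w) \<bullet> W w \<partial>M) = (\<Sum>i=1..n. r * (\<integral>w. (A w + N w) \<bullet> err i k w \<partial>M))"
      unfolding W_def inner_sum_right using square_integrable_inner[OF AN_sq err_sq]
      by (subst Bochner_Integration.integral_sum) auto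
    also have "\<dots> = 0" using err_orthogonal[OF _ AN_sq AN_info] by simp
    finally show "(\<integral>w. (A w + N w) \<bullet> W w \<partial>M) = 0" .
  qed
  also have "(\<integral>w. (norm (A w + N w))\<^sup>2 \<partial>M) = (\<integral>w. (norm (A w))\<^sup>2 \<partial>M) + (\<integral>w. (norm (N w))\<^sup>2 \<partial>M)"
  proof (rule integral_norm_sq_add[OF A_sq N_sq])
    have A_F: "A \<in> borel_measurable (F k)"
    proof -
      have [measurable]: "x k \<in> borel_measurable (F k)" using x_measurable .
      have [measurable]: "(\<lambda>w. grad (f i) (x k w)) \<in> borel_measurable (F k)" if "i \<in> {1..n}" for i
        using that by (rule grad_measurable)
      show ?thesis unfolding A_def gdiff_def by measurable
    qed
    have "(\<integral>w. A w \<bullet> N w \<partial>M) = (\<Sum>i=1..n. r * (\<integral>w. A w \<bullet> noise i k w \<partial>M))"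
      unfolding N_def inner_sum_right using square_integrable_inner[OF A_sq noise_square_integrable]
      by (subst Bochner_Integration.integral_sum) auto
    also have "\<dots> = 0" using noise_orthogonal[OF _ A_sq A_F] by simp
    finally show "(\<integral>w. A w \<bullet> N w \<partial>M) = 0" .
  qed
  finally have split: "(\<integral>w. (norm (x (Suc k) w - xs))\<^sup>2 \<partial>M)
      \<le> (\<integral>w. (norm (A w))\<^sup>2 \<partial>M) + (\<integral>w. (norm (N w))\<^sup>2 \<partial>M) + (\<integral>w. (norm (W w))\<^sup>2 \<partial>M)" .
  have gint: "integrable M (\<lambda>w. (norm (gdiff i k w))\<^sup>2)" if "i \<in> {1..n}" for i
    using that by (intro square_integrable_norm_sq gdiff_sq)
  have nint: "integrable M (\<lambda>w. (norm (noise i k w))\<^sup>2)" if "i \<in> {1..n}" for i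
    using that by (intro square_integrable_norm_sq noise_square_integrable)
  define q where "q = \<gamma>\<^sup>2 / real n - 2 * \<gamma> / (real n * (\<mu> + L))"
  have dint: "integrable M (\<lambda>w. (1 - \<gamma> * \<mu>) * (norm (x k w - xs))\<^sup>2)"
    using square_integrable_norm_sq[OF dist_sq] by (intro integrable_mult_right)
  have qint: "integrable M (\<lambda>w. q * (\<Sum>i=1..n. (norm (gdiff i k w))\<^sup>2))"
    using gint by (intro integrable_mult_right Bochner_Integration.integrable_sum)
  have "(\<integral>w. (norm (A w))\<^sup>2 \<partial>M) \<le> (\<integral>w. (1 - \<gamma> * \<mu>) * (norm (x k w - xs))\<^sup>2
      + q * (\<Sum>i=1..n. (norm (gdiff i k w))\<^sup>2) \<partial>M)"
    using gradient_step_contracts square_integrable_norm_sq[OF A_sq]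
      Bochner_Integration.integrable_add[OF dint qint]
    unfolding A_def q_def by (intro integral_mono)
  also have "\<dots> = (1 - \<gamma> * \<mu>) * dist2 + q * (\<Sum>i=1..n. gdiff2 i)"
    by (simp only: Bochner_Integration.integral_add[OF dint qint] integral_mult_right_zero
        Bochner_Integration.integral_sum[OF gint])
  finally have boundA: "(\<integral>w. (norm (A w))\<^sup>2 \<partial>M)
      \<le> (1 - \<gamma> * \<mu>) * dist2 + q * (\<Sum>i=1..n. gdiff2 i)" .
  have "(norm (N w))\<^sup>2 \<le> \<gamma>\<^sup>2 / real n * (\<Sum>i=1..n. (norm (noise i k w))\<^sup>2)" for w
  proof -
    have "(norm (N w))\<^sup>2 \<le> real n * (\<Sum>i=1..n. (norm (r *\<^sub>R noise i k w))\<^sup>2)"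
      unfolding N_def using norm_sum_sq_le[of "{1..n}" "\<lambda>i. r *\<^sub>R noise i k w"] by simp
    also have "\<dots> = \<gamma>\<^sup>2 / real n * (\<Sum>i=1..n. (norm (noise i k w))\<^sup>2)"
      by (simp add: power_mult_distrib flip: sum_distrib_left)
        (simp add: r_def power2_eq_square)
    finally show ?thesis .
  qed
  then have "(\<integral>w. (norm (N w))\<^sup>2 \<partial>M) \<le> (\<integral>w. \<gamma>\<^sup>2 / real n * (\<Sum>i=1..n. (norm (noise i k w))\<^sup>2) \<partial>M)"
    using nint square_integrable_norm_sq[OF N_sq]
    by (intro integral_mono integrable_mult_right Bochner_Integration.integrable_sum) auto
  also have "\<dots> = \<gamma>\<^sup>2 / real n * (\<Sum>i=1..n. \<integral>w. (norm (noise i k w))\<^sup>2 \<partial>M)"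
    using nint by (simp add: Bochner_Integration.integral_sum)
  also have "\<dots> \<le> \<gamma>\<^sup>2 / real n * (\<Sum>i=1..n. (\<sigma> i)\<^sup>2)"
    using noise_bound by (intro mult_left_mono sum_mono) (auto simp: noise_def)
  finally have boundN: "(\<integral>w. (norm (N w))\<^sup>2 \<partial>M) \<le> \<gamma>\<^sup>2 / real n * (\<Sum>i=1..n. (\<sigma> i)\<^sup>2)" .
  have "(\<integral>w. (norm (W w))\<^sup>2 \<partial>M) = (\<Sum>i=1..n. \<integral>w. (norm (r *\<^sub>R err i k w))\<^sup>2 \<partial>M)"
    unfolding W_def
  proof (rule integral_norm_sq_sum)
    fix i j assume "i \<in> {1..n}" "j \<in> {1..n}" "i \<noteq> j"
    from err_uncorrelated[OF this]
    show "(\<integral>w. (r *\<^sub>R err i k w) \<bullet> (r *\<^sub>R err j k w) \<partial>M) = 0" by simp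
  qed (simp_all add: square_integrable_scaleR err_sq)
  also have "\<dots> = (\<Sum>i=1..n. r\<^sup>2 * (\<integral>w. (norm (err i k w))\<^sup>2 \<partial>M))"
    by (simp add: power_mult_distrib)
  also have "\<dots> \<le> (\<Sum>i=1..n. r\<^sup>2 * (\<omega> * (2 * gdiff2 i + 2 * shift_diff2 i + (\<sigma> i)\<^sup>2)))"
  proof (intro sum_mono mult_left_mono)
    fix i assume i: "i \<in> {1..n}"
    show "(\<integral>w. (norm (err i k w))\<^sup>2 \<partial>M) \<le> \<omega> * (2 * gdiff2 i + 2 * shift_diff2 i + (\<sigma> i)\<^sup>2)"
      using err_variance[OF i] mult_left_mono[OF diff_second_moment[OF i] \<omega>_nonneg] by linarith
  qed simp
  also have "\<dots> = \<gamma>\<^sup>2 * \<omega> / (real n)\<^sup>2 * (\<Sum>i=1..n. 2 * gdiff2 i + 2 * shift_diff2 i + (\<sigma> i)\<^sup>2)"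
    by (simp add: sum_distrib_left r_def power_divide mult.assoc)
  finally have boundW: "(\<integral>w. (norm (W w))\<^sup>2 \<partial>M)
      \<le> \<gamma>\<^sup>2 * \<omega> / (real n)\<^sup>2 * (\<Sum>i=1..n. 2 * gdiff2 i + 2 * shift_diff2 i + (\<sigma> i)\<^sup>2)" .
  show "(\<integral>w. (norm (x (Suc k) w - xs))\<^sup>2 \<partial>M)
      \<le> (1 - \<gamma> * \<mu>) * dist2 + (\<gamma>\<^sup>2 / real n - 2 * \<gamma> / (real n * (\<mu> + L))) * (\<Sum>i=1..n. gdiff2 i)
        + \<gamma>\<^sup>2 / real n * (\<Sum>i=1..n. (\<sigma> i)\<^sup>2)
        + \<gamma>\<^sup>2 * \<omega> / (real n)\<^sup>2 * (\<Sum>i=1..n. 2 * gdiff2 i + 2 * shift_diff2 i + (\<sigma> i)\<^sup>2)"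
    unfolding q_def[symmetric] using split boundA boundN boundW by linarith
qed

text \<open>The condition on \<open>\<alpha>\<close> lets the quantization error of the shift be absorbed: without
  quantization the new squared distance would differ from the convex combination on the right by
  \<open>(\<alpha>\<^sup>2 - \<alpha>)\<close> times the squared length of the transmitted difference, and the error adds
  at most \<open>\<alpha>\<^sup>2 \<omega>\<close> times that.\<close>

lemma h_step:
  assumes i: "i \<in> {1..n}" and \<alpha>: "\<alpha> \<ge> 0" "\<alpha> * (\<omega> + 1) \<le> 1"
  shows "square_integrable M (h i (Suc k))"
    and "(\<integral>w. (norm (shift_diff i (Suc k) w))\<^sup>2 \<partial>M) \<le> (1 - \<alpha>) * shift_diff2 i + \<alpha> * (gdiff2 i + (\<sigma> i)\<^sup>2)"
proof -
  define D where "D = (\<lambda>w. g i k w - h i k w)"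
  define P where "P = (\<lambda>w. shift_diff i k w + \<alpha> *\<^sub>R D w)"
  have D_sq: "square_integrable M D" unfolding D_def using diff_sq[OF i] .
  have P_sq: "square_integrable M P" unfolding P_def
    using shift_diff_sq[OF i] D_sq by (intro square_integrable_add square_integrable_scaleR)
  have E_sq: "square_integrable M (\<lambda>w. \<alpha> *\<^sub>R err i k w)"
    by (intro square_integrable_scaleR err_sq i)
  have step: "shift_diff i (Suc k) w = P w + \<alpha> *\<^sub>R err i k w" if "w \<in> space M" for w
    using that i by (simp add: shift_diff_def run_h P_def D_def quantized_diff_eq scaleR_add_right)
  have "shift_diff i (Suc k) \<in> borel_measurable M"
    using history_M[OF h_measurable[OF i]] by (simp add: shift_diff_def[abs_def])
  then have "square_integrable M (shift_diff i (Suc k))"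
    using step by (intro square_integrable_bound[OF square_integrable_add[OF P_sq E_sq], where r=1]) simp_all
  from square_integrable_add[OF this square_integrable_const[of "gopt i"]]
  show "square_integrable M (h i (Suc k))" by (simp add: shift_diff_def)
  have P_info: "P \<in> borel_measurable (info k)"
    using history_info[OF h_measurable[OF i]] diff_info[OF i]
    unfolding P_def D_def shift_diff_def by measurable
  have Gn_sq: "square_integrable M (\<lambda>w. gdiff i k w + noise i k w)"
    by (intro square_integrable_add gdiff_sq noise_square_integrable i)
  have "(\<integral>w. (norm (shift_diff i (Suc k) w))\<^sup>2 \<partial>M) = (\<integral>w. (norm (P w + \<alpha> *\<^sub>R err i k w))\<^sup>2 \<partial>M)"
    using step by (intro Bochner_Integration.integral_cong) simp_all
  also have "\<dots> = (\<integral>w. (norm (P w))\<^sup>2 \<partial>M) + (\<integral>w. (norm (\<alpha> *\<^sub>R err i k w))\<^sup>2 \<partial>M)"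
    using err_orthogonal[OF i P_sq P_info] by (intro integral_norm_sq_add P_sq E_sq) simp
  also have "(\<integral>w. (norm (\<alpha> *\<^sub>R err i k w))\<^sup>2 \<partial>M) = \<alpha>\<^sup>2 * (\<integral>w. (norm (err i k w))\<^sup>2 \<partial>M)"
    by (simp add: power_mult_distrib)
  also have "\<dots> \<le> \<alpha>\<^sup>2 * (\<omega> * (\<integral>w. (norm (D w))\<^sup>2 \<partial>M))"
    using err_variance[OF i] by (intro mult_left_mono) (simp_all add: D_def)
  also have "(\<integral>w. (norm (P w))\<^sup>2 \<partial>M) + \<alpha>\<^sup>2 * (\<omega> * (\<integral>w. (norm (D w))\<^sup>2 \<partial>M))
      = (\<integral>w. (norm (P w))\<^sup>2 + \<alpha>\<^sup>2 * \<omega> * (norm (D w))\<^sup>2 \<partial>M)"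
    using P_sq D_sq by (simp add: square_integrable_norm_sq)
  also have "\<dots> \<le> (\<integral>w. (1 - \<alpha>) * (norm (shift_diff i k w))\<^sup>2 + \<alpha> * (norm (gdiff i k w + noise i k w))\<^sup>2 \<partial>M)"
  proof (rule integral_mono)
    fix w
    have "\<alpha> * (\<alpha> * (\<omega> + 1)) \<le> \<alpha> * 1" using \<alpha> by (intro mult_left_mono)
    then have "\<alpha> * (\<alpha> * (\<omega> + 1)) * (norm (D w))\<^sup>2 \<le> \<alpha> * 1 * (norm (D w))\<^sup>2"
      by (intro mult_right_mono) auto
    moreover have "gdiff i k w + noise i k w = shift_diff i k w + D w"
      by (simp add: D_def diff_eq)
    ultimately show "(norm (P w))\<^sup>2 + \<alpha>\<^sup>2 * \<omega> * (norm (D w))\<^sup>2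
        \<le> (1 - \<alpha>) * (norm (shift_diff i k w))\<^sup>2 + \<alpha> * (norm (gdiff i k w + noise i k w))\<^sup>2"
      unfolding P_def power2_norm_eq_inner
      by (simp add: inner_add_left inner_add_right inner_commute algebra_simps power2_eq_square)
  qed (use P_sq D_sq Gn_sq shift_diff_sq[OF i] in \<open>simp_all add: square_integrable_norm_sq\<close>)
  also have "\<dots> = (1 - \<alpha>) * shift_diff2 i + \<alpha> * (\<integral>w. (norm (gdiff i k w + noise i k w))\<^sup>2 \<partial>M)"
    using Gn_sq shift_diff_sq[OF i] by (simp add: square_integrable_norm_sq)
  also have "(\<integral>w. (norm (gdiff i k w + noise i k w))\<^sup>2 \<partial>M) = gdiff2 i + (\<integral>w. (norm (noise i k w))\<^sup>2 \<partial>M)"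
  proof -
    have "gdiff i k \<in> borel_measurable (F k)"
      using grad_measurable[OF i] by (simp add: gdiff_def[abs_def])
    then show ?thesis
      by (intro integral_norm_sq_add gdiff_sq noise_square_integrable noise_orthogonal i)
  qed
  also have "\<dots> \<le> gdiff2 i + (\<sigma> i)\<^sup>2" using noise_bound[OF i, of k] by (simp add: noise_def)
  finally show "(\<integral>w. (norm (shift_diff i (Suc k) w))\<^sup>2 \<partial>M) \<le> (1 - \<alpha>) * shift_diff2 i + \<alpha> * (gdiff2 i + (\<sigma> i)\<^sup>2)"
    using \<alpha> by (simp add: mult_left_mono)
qed

end

section \<open>Decrease of the Lyapunov function\<close>

text \<open>Here \<open>a\<close>, \<open>H\<close> and \<open>G\<close> stand for the expected squared distances of the iterate, the
  shifts and the gradients from their values at the solution, and \<open>S\<close> for the sum of the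
  variance bounds. The step size bound makes the coefficient of \<open>G\<close> nonpositive. The weight \<open>c\<close> is
  large enough for half of the decrease \<open>\<alpha>\<close> of the shifts to cover the \<open>H\<close> that comes from
  quantization; \<open>\<gamma> \<mu> \<le> \<alpha> / 2\<close> leaves the other half for the contraction.\<close>

lemma lyapunov_contraction_arithmetic:
  fixes G H S :: real
  assumes x': "a' \<le> (1 - \<gamma> * \<mu>) * a + (\<gamma>\<^sup>2 / n - 2 * \<gamma> / (n * (\<mu> + L))) * G
      + \<gamma>\<^sup>2 / n * S + \<gamma>\<^sup>2 * \<omega> / n\<^sup>2 * (2 * G + 2 * H + S)"
    and h': "H' \<le> (1 - \<alpha>) * H + \<alpha> * (G + S)"
    and nonneg: "G \<ge> 0" "H \<ge> 0" "S \<ge> 0" "\<omega> \<ge> 0"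
    and pos: "n > 0" "\<mu> > 0" "L > 0" "\<gamma> > 0" "\<alpha> > 0"
    and c: "c \<ge> 4 * \<omega> / (\<alpha> * n)"
    and \<gamma>: "\<gamma> \<le> 2 / ((\<mu> + L) * (1 + 2 * \<omega> / n + c * \<alpha>))" "\<gamma> \<le> \<alpha> / (2 * \<mu>)"
  shows "a' + c * \<gamma>\<^sup>2 / n * H' \<le> (1 - \<gamma> * \<mu>) * (a + c * \<gamma>\<^sup>2 / n * H)
      + \<gamma>\<^sup>2 * (1 + 2 * \<omega> / n + c * \<alpha>) * (S / n)"
proof -
  define u p where "u = \<omega> / n" and "p = \<gamma>\<^sup>2 / n"
  have u: "u \<ge> 0" and p: "p \<ge> 0" using nonneg pos by (simp_all add: u_def p_def)
  have "0 \<le> 4 * \<omega> / (\<alpha> * n)" using nonneg pos by simp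
  then have c0: "c \<ge> 0" using c by linarith
  have cu: "2 * u \<le> c * \<alpha> / 2"
    using c pos by (simp add: u_def field_simps)
  have "\<gamma> * \<mu> \<le> \<alpha> / 2" using \<gamma>(2) pos by (simp add: field_simps)
  then have "c * (\<gamma> * \<mu>) \<le> c * (\<alpha> / 2)" using c0 by (rule mult_left_mono)
  with cu have coefH: "c * (1 - \<alpha>) + 2 * u \<le> c * (1 - \<gamma> * \<mu>)" by (simp add: algebra_simps)
  define \<theta> where "\<theta> = 1 + 2 * u + c * \<alpha>"
  have "\<theta> > 0" using u c0 pos by (simp add: \<theta>_def add_pos_nonneg)
  moreover have "\<gamma> \<le> 2 / ((\<mu> + L) * \<theta>)" using \<gamma>(1) by (simp add: \<theta>_def u_def)
  ultimately have "\<gamma> * \<theta> \<le> 2 / (\<mu> + L)"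
    by (simp only: divide_divide_eq_left[symmetric] pos_le_divide_eq)
  then have "\<gamma> / n * (\<gamma> * \<theta>) \<le> \<gamma> / n * (2 / (\<mu> + L))"
    using pos by (intro mult_left_mono) auto
  then have coefG: "p * (1 + 2 * u + c * \<alpha>) - 2 * \<gamma> / (n * (\<mu> + L)) \<le> 0"
    unfolding \<theta>_def[symmetric] by (simp add: p_def power2_eq_square mult_ac)
  have "c * p * H' \<le> c * p * ((1 - \<alpha>) * H + \<alpha> * (G + S))"
    using h' c0 p by (intro mult_left_mono) auto
  moreover have "\<gamma>\<^sup>2 * \<omega> / n\<^sup>2 = p * u" by (simp add: p_def u_def power2_eq_square)
  ultimately have "a' + c * p * H' \<le> (1 - \<gamma> * \<mu>) * a + (p - 2 * \<gamma> / (n * (\<mu> + L))) * G + p * S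
      + p * u * (2 * G + 2 * H + S) + c * p * ((1 - \<alpha>) * H + \<alpha> * (G + S))"
    using x' by (simp add: p_def)
  also have "\<dots> = (1 - \<gamma> * \<mu>) * a + (p * (1 + 2 * u + c * \<alpha>) - 2 * \<gamma> / (n * (\<mu> + L))) * G
      + p * H * (c * (1 - \<alpha>) + 2 * u) + p * S * (1 + u + c * \<alpha>)"
    by (simp add: algebra_simps)
  also have "\<dots> \<le> (1 - \<gamma> * \<mu>) * a + 0 + p * H * (c * (1 - \<gamma> * \<mu>)) + p * S * (1 + 2 * u + c * \<alpha>)"
    using coefG coefH u p nonneg
    by (intro add_mono mult_left_mono mult_nonpos_nonneg mult_nonneg_nonneg order_refl) simp_all
  also have "\<dots> = (1 - \<gamma> * \<mu>) * (a + c * p * H) + \<gamma>\<^sup>2 * (1 + 2 * \<omega> / n + c * \<alpha>) * (S / n)"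
    by (simp add: p_def u_def algebra_simps)
  finally show ?thesis by (simp add: p_def)
qed

context diana
begin

lemma iterates_square_integrable:
  assumes \<alpha>: "\<alpha> \<ge> 0" "\<alpha> * (\<omega> + 1) \<le> 1"
  shows "square_integrable M (x k) \<and> (\<forall>i\<in>{1..n}. square_integrable M (h i k))"
proof (induction k)
  case 0
  have "square_integrable M X" if "X \<in> borel_measurable M" "\<And>w. w \<in> space M \<Longrightarrow> X w = v"
    for X :: "'w \<Rightarrow> 'a" and v
    using that by (intro square_integrable_bound[OF square_integrable_const[of v], where r=1]) auto
  then show ?case
    using history_M[OF x_measurable] history_M[OF h_measurable] run_0 by metis
next
  case (Suc k)
  interpret it: diana_iteration M Z f R Q \<xi> g h x F x0 xs h0 n \<sigma> \<mu> L \<omega> \<alpha> \<gamma> k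
    using Suc by unfold_locales auto
  show ?case using it.x_step(1) it.h_step(1)[OF _ \<alpha>] by blast
qed

lemma lyapunov_expectation:
  assumes sq: "square_integrable M (x k)" "\<And>i. i \<in> {1..n} \<Longrightarrow> square_integrable M (h i k)"
  shows "integrable M (\<lambda>w. lyapunov n f c \<gamma> xs (x k w) (\<lambda>i. h i k w))"
    and "(\<integral>w. lyapunov n f c \<gamma> xs (x k w) (\<lambda>i. h i k w) \<partial>M)
      = (\<integral>w. (norm (x k w - xs))\<^sup>2 \<partial>M) + c * \<gamma>\<^sup>2 / real n * (\<Sum>i=1..n. \<integral>w. (norm (shift_diff i k w))\<^sup>2 \<partial>M)"
proof -
  have X: "integrable M (\<lambda>w. (norm (x k w - xs))\<^sup>2)"
    using sq(1) by (intro square_integrable_norm_sq square_integrable_diff square_integrable_const)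
  have H: "integrable M (\<lambda>w. (norm (h i k w - gopt i))\<^sup>2)" if "i \<in> {1..n}" for i
    using sq(2)[OF that] by (intro square_integrable_norm_sq square_integrable_diff square_integrable_const)
  have S: "integrable M (\<lambda>w. c * \<gamma>\<^sup>2 / real n * (\<Sum>i=1..n. (norm (h i k w - gopt i))\<^sup>2))"
    using H by (intro integrable_mult_right Bochner_Integration.integrable_sum)
  show "integrable M (\<lambda>w. lyapunov n f c \<gamma> xs (x k w) (\<lambda>i. h i k w))"
    using X S unfolding lyapunov_def gopt_def by (rule Bochner_Integration.integrable_add)
  show "(\<integral>w. lyapunov n f c \<gamma> xs (x k w) (\<lambda>i. h i k w) \<partial>M)
      = (\<integral>w. (norm (x k w - xs))\<^sup>2 \<partial>M) + c * \<gamma>\<^sup>2 / real n * (\<Sum>i=1..n. \<integral>w. (norm (shift_diff i k w))\<^sup>2 \<partial>M)"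
    unfolding lyapunov_def gopt_def[symmetric] shift_diff_def
    by (simp only: Bochner_Integration.integral_add[OF X S] integral_mult_right_zero
        Bochner_Integration.integral_sum[OF H])
qed

text \<open>The additive term is the fixed point bound of the recursion
  \<open>V (Suc k) \<le> (1 - \<gamma> \<mu>) V k + \<gamma>\<^sup>2 \<theta> s\<close>: the step size condition bounds \<open>\<gamma> \<theta>\<close>
  by \<open>2 / (\<mu> + L)\<close>.\<close>

theorem expected_lyapunov_bound:
  assumes \<alpha>: "\<alpha> > 0" "\<alpha> * (\<omega> + 1) \<le> 1" and c: "c \<ge> 4 * \<omega> / (\<alpha> * real n)"
    and \<gamma>: "\<gamma> \<le> 2 / ((\<mu> + L) * (1 + 2 * \<omega> / real n + c * \<alpha>))" "\<gamma> \<le> \<alpha> / (2 * \<mu>)"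
  shows "integrable M (\<lambda>w. lyapunov n f c \<gamma> xs (x k w) (\<lambda>i. h i k w))"
    and "(\<integral>w. lyapunov n f c \<gamma> xs (x k w) (\<lambda>i. h i k w) \<partial>M)
      \<le> (1 - \<gamma> * \<mu>) ^ k * lyapunov n f c \<gamma> xs x0 h0
        + 2 / (\<mu> * (\<mu> + L)) * (1 / real n * (\<Sum>i=1..n. (\<sigma> i)\<^sup>2))"
proof -
  define s where "s = 1 / real n * (\<Sum>i=1..n. (\<sigma> i)\<^sup>2)"
  define V where "V = (\<lambda>k. \<integral>w. lyapunov n f c \<gamma> xs (x k w) (\<lambda>i. h i k w) \<partial>M)"
  define b where "b = 2 / (\<mu> * (\<mu> + L)) * s"
  define \<theta> where "\<theta> = 1 + 2 * \<omega> / real n + c * \<alpha>"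
  note sq = iterates_square_integrable[OF less_imp_le[OF \<alpha>(1)] \<alpha>(2)]
  show "integrable M (\<lambda>w. lyapunov n f c \<gamma> xs (x k w) (\<lambda>i. h i k w))"
    using sq[of k] by (intro lyapunov_expectation(1)) auto
  have s: "s \<ge> 0" unfolding s_def by (intro mult_nonneg_nonneg sum_nonneg) auto
  have step: "V (Suc k) \<le> (1 - \<gamma> * \<mu>) * V k + \<gamma>\<^sup>2 * \<theta> * s" for k
  proof -
    interpret it: diana_iteration M Z f R Q \<xi> g h x F x0 xs h0 n \<sigma> \<mu> L \<omega> \<alpha> \<gamma> k
      using sq[of k] by unfold_locales auto
    define G H S H' where "G = (\<Sum>i=1..n. it.gdiff2 i)" and "H = (\<Sum>i=1..n. it.shift_diff2 i)"
      and "S = (\<Sum>i=1..n. (\<sigma> i)\<^sup>2)" and "H' = (\<Sum>i=1..n. \<integral>w. (norm (shift_diff i (Suc k) w))\<^sup>2 \<partial>M)"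
    have "H' \<le> (\<Sum>i=1..n. (1 - \<alpha>) * it.shift_diff2 i + \<alpha> * (it.gdiff2 i + (\<sigma> i)\<^sup>2))"
      unfolding H'_def using \<alpha> by (intro sum_mono it.h_step(2)) simp_all
    also have "\<dots> = (1 - \<alpha>) * H + \<alpha> * (G + S)"
      by (simp add: G_def H_def S_def sum.distrib sum_distrib_left distrib_left)
    finally have H': "H' \<le> (1 - \<alpha>) * H + \<alpha> * (G + S)" .
    have "(\<Sum>i=1..n. 2 * it.gdiff2 i + 2 * it.shift_diff2 i + (\<sigma> i)\<^sup>2) = 2 * G + 2 * H + S"
      by (simp add: G_def H_def S_def sum.distrib sum_distrib_left)
    note x' = it.x_step(2)[unfolded this, folded G_def S_def]
    have "G \<ge> 0" "H \<ge> 0" "S \<ge> 0" by (simp_all add: G_def H_def S_def sum_nonneg)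
    from lyapunov_contraction_arithmetic[OF x' H' this \<omega>_nonneg n_pos \<mu>_pos L_pos \<gamma>_pos \<alpha>(1) c \<gamma>]
    moreover have "V j = (\<integral>w. (norm (x j w - xs))\<^sup>2 \<partial>M)
        + c * \<gamma>\<^sup>2 / real n * (\<Sum>i=1..n. \<integral>w. (norm (shift_diff i j w))\<^sup>2 \<partial>M)" for j
      unfolding V_def using sq[of j] by (intro lyapunov_expectation(2)) auto
    ultimately show ?thesis
      by (simp add: H_def H'_def S_def s_def \<theta>_def)
  qed
  have \<gamma>\<mu>: "\<gamma> * \<mu> \<le> 1"
  proof -
    have "\<alpha> * 1 \<le> \<alpha> * (\<omega> + 1)" using \<alpha> \<omega>_nonneg by (intro mult_left_mono) auto
    then have "\<alpha> \<le> 1" using \<alpha>(2) by linarith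
    moreover have "\<gamma> * \<mu> \<le> \<alpha> / 2" using \<gamma>(2) \<mu>_pos by (simp add: field_simps)
    ultimately show ?thesis by simp
  qed
  have absorb: "\<gamma>\<^sup>2 * \<theta> * s \<le> \<gamma> * \<mu> * b"
  proof -
    have "0 \<le> 4 * \<omega> / (\<alpha> * real n)" using \<omega>_nonneg \<alpha> by simp
    then have "c * \<alpha> \<ge> 0" using c \<alpha> by simp
    then have "\<theta> > 0" using \<omega>_nonneg by (simp add: \<theta>_def add_pos_nonneg)
    then have "\<gamma> * \<theta> \<le> 2 / (\<mu> + L)"
      using \<gamma>(1) unfolding \<theta>_def[symmetric]
      by (simp only: divide_divide_eq_left[symmetric] pos_le_divide_eq)
    then have "\<gamma> * (\<gamma> * \<theta>) * s \<le> \<gamma> * (2 / (\<mu> + L)) * s"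
      using \<gamma>_pos s by (intro mult_right_mono mult_left_mono) auto
    also have "\<dots> = \<gamma> * \<mu> * b" using \<mu>_pos by (simp add: b_def)
    finally show ?thesis by (simp add: power2_eq_square mult_ac)
  qed
  have "V k \<le> (1 - \<gamma> * \<mu>) ^ k * lyapunov n f c \<gamma> xs x0 h0 + b" for k
  proof (induction k)
    case 0
    have "V 0 = (\<integral>w. lyapunov n f c \<gamma> xs x0 h0 \<partial>M)"
      unfolding V_def by (intro Bochner_Integration.integral_cong) (simp_all add: lyapunov_def run_0)
    moreover have "b \<ge> 0" using s \<mu>_pos L_pos by (simp add: b_def)
    ultimately show ?case by (simp add: prob_space)
  next
    case (Suc k)
    have "(1 - \<gamma> * \<mu>) * V k
        \<le> (1 - \<gamma> * \<mu>) * ((1 - \<gamma> * \<mu>) ^ k * lyapunov n f c \<gamma> xs x0 h0 + b)"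
      using Suc \<gamma>\<mu> by (intro mult_left_mono) auto
    with step[of k] absorb show ?case by (simp add: algebra_simps)
  qed
  then show "(\<integral>w. lyapunov n f c \<gamma> xs (x k w) (\<lambda>i. h i k w) \<partial>M)
      \<le> (1 - \<gamma> * \<mu>) ^ k * lyapunov n f c \<gamma> xs x0 h0
        + 2 / (\<mu> * (\<mu> + L)) * (1 / real n * (\<Sum>i=1..n. (\<sigma> i)\<^sup>2))"
    by (simp only: V_def b_def s_def)
qed

end

section \<open>Step size and iteration complexity\<close>

lemma geometric_decay_below:
  fixes r P \<epsilon> :: real
  assumes r: "0 < r" "r \<le> 1" and P: "P \<ge> 0" and \<epsilon>: "\<epsilon> > 0" and k: "real k \<ge> 1 / r * ln (P / \<epsilon>)"
  shows "(1 - r) ^ k * P \<le> \<epsilon>"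
proof (cases "P = 0")
  case True
  then show ?thesis using \<epsilon> by simp
next
  case False
  then have P: "P > 0" using P by simp
  have "(1 - r) ^ k \<le> exp (- r) ^ k"
    using r exp_ge_add_one_self[of "- r"] by (intro power_mono) auto
  also have "\<dots> = exp (- (real k * r))" by (simp add: exp_of_nat_mult[symmetric])
  also have "\<dots> \<le> exp (- ln (P / \<epsilon>))" using k r by (simp add: field_simps)
  also have "\<dots> = \<epsilon> / P" using P \<epsilon> by (simp add: exp_minus)
  finally show ?thesis using P by (simp add: field_simps)
qed

lemma diana_step_size_reciprocal:
  fixes \<mu> L \<omega> m \<gamma> \<kappa> :: real
  assumes pos: "\<mu> > 0" "L > 0" "m > 0" "\<omega> \<ge> 0"
    and \<gamma>: "\<gamma> = min (2 / ((\<mu> + L) * (1 + 6 * \<omega> / m))) (1 / (2 * \<mu> * (\<omega> + 1)))"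
    and \<kappa>: "\<kappa> = (L + \<mu>) / (2 * \<mu>)"
  shows "1 / (\<gamma> * \<mu>) = max (\<kappa> + \<kappa> * (6 * \<omega> / m)) (2 * (\<omega> + 1))"
proof -
  define A B where "A = \<kappa> + \<kappa> * (6 * \<omega> / m)" and "B = 2 * (\<omega> + 1)"
  have "\<kappa> > 0" using pos by (simp add: \<kappa>)
  then have AB: "A > 0" "B > 0" using pos by (simp_all add: A_def B_def add_pos_nonneg)
  have "2 * \<mu> * A = (\<mu> + L) * (1 + 6 * \<omega> / m)"
    using pos by (simp add: A_def \<kappa> field_simps)
  then have "2 / ((\<mu> + L) * (1 + 6 * \<omega> / m)) = 1 / (\<mu> * A)"
    by (simp flip: \<open>2 * \<mu> * A = _\<close>)
  then have "\<gamma> = min (1 / (\<mu> * A)) (1 / (\<mu> * B))" by (simp add: \<gamma> B_def mult_ac)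
  also have "\<dots> = 1 / (\<mu> * max A B)"
    using AB pos by (auto simp: min_def max_def field_simps)
  finally show ?thesis using pos by (simp add: A_def B_def)
qed

theorem corollary1:
  fixes M :: "'w measure" and Z :: "'z measure"
    and f :: "nat \<Rightarrow> real ^ 'd \<Rightarrow> real"
    and R :: "real ^ 'd \<Rightarrow> ereal"
    and Q :: "'z \<Rightarrow> real ^ 'd \<Rightarrow> real ^ 'd"
    and \<xi> :: "nat \<Rightarrow> nat \<Rightarrow> 'w \<Rightarrow> 'z"
    and g h :: "nat \<Rightarrow> nat \<Rightarrow> 'w \<Rightarrow> real ^ 'd"
    and x :: "nat \<Rightarrow> 'w \<Rightarrow> real ^ 'd"
    and F :: "nat \<Rightarrow> 'w measure"
    and x0 xs :: "real ^ 'd" and h0 :: "nat \<Rightarrow> real ^ 'd"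
    and n :: nat and \<sigma> :: "nat \<Rightarrow> real"
    and \<mu> L \<omega> \<alpha> \<gamma> c \<kappa> \<sigma>2 \<Psi>0 :: real
    and \<Psi> :: "nat \<Rightarrow> 'w \<Rightarrow> real"
  assumes "prob_space M"
    and "n \<ge> 1"
    and "\<And>i. i \<in> {1..n} \<Longrightarrow> strongly_convex \<mu> (f i)"
    and "\<And>i. i \<in> {1..n} \<Longrightarrow> smooth L (f i)"
    and "closed_convex_regularizer R"
    and "is_arg_min (\<lambda>y. ereal (1 / real n * (\<Sum>i=1..n. f i y)) + R y) (\<lambda>_. True) xs"
    and "quantization_operator \<omega> Z Q"
    and "diana_run M n \<alpha> \<gamma> R Q \<xi> g x0 h0 x h"
    and "diana_history M n F Q \<xi> g h"
    and "\<And>i k. i \<in> {1..n} \<Longrightarrow> has_cond_mean M (F k) (g i k) (\<lambda>w. grad (f i) (x k w))"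
    and "\<And>k. cond_indep_vars M (F k) borel (\<lambda>i. g i k) {1..n}"
    and "\<And>k. fresh_seeds M (history_with_gradients M n F g k) Z (\<lambda>i. \<xi> i k) {1..n}"
    and "\<And>i k. i \<in> {1..n} \<Longrightarrow> integrable M (\<lambda>w. (norm (g i k w - grad (f i) (x k w)))\<^sup>2)"
    and "\<And>i k. i \<in> {1..n} \<Longrightarrow>
           integral\<^sup>L M (\<lambda>w. (norm (g i k w - grad (f i) (x k w)))\<^sup>2) \<le> (\<sigma> i)\<^sup>2"
    and "\<sigma>2 = 1 / real n * (\<Sum>i=1..n. (\<sigma> i)\<^sup>2)"
    and "c = 4 * \<omega> / (\<alpha> * real n)"
    and "\<alpha> = 1 / (\<omega> + 1)"
    and "\<gamma> = min (2 / ((\<mu> + L) * (1 + 6 * \<omega> / real n))) (1 / (2 * \<mu> * (\<omega> + 1)))"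
    and "\<kappa> = (L + \<mu>) / (2 * \<mu>)"
    and "\<And>k w. \<Psi> k w = lyapunov n f c \<gamma> xs (x k w) (\<lambda>i. h i k w)"
    and "\<Psi>0 = lyapunov n f c \<gamma> xs x0 h0"
  shows "\<alpha> \<le> 1 / (\<omega> + 1) \<and>
    c \<ge> 4 * \<omega> / (\<alpha> * real n) \<and>
    \<gamma> \<le> 2 / ((\<mu> + L) * (1 + 2 * \<omega> / real n + c * \<alpha>)) \<and>
    \<gamma> \<le> \<alpha> / (2 * \<mu>) \<and>
    (\<forall>k. integrable M (\<Psi> k) \<and>
         integral\<^sup>L M (\<Psi> k) \<le> (1 - \<gamma> * \<mu>) ^ k * \<Psi>0 + 2 / (\<mu> * (\<mu> + L)) * \<sigma>2) \<and>
    (\<forall>\<epsilon>>0. \<forall>k. real k \<ge> 1 / (\<gamma> * \<mu>) * ln (\<Psi>0 / \<epsilon>) \<longrightarrow>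
         integral\<^sup>L M (\<Psi> k) \<le> \<epsilon> + 2 / (\<mu> * (\<mu> + L)) * \<sigma>2) \<and>
    1 / (\<gamma> * \<mu>) = max (\<kappa> + \<kappa> * (6 * \<omega> / real n)) (2 * (\<omega> + 1)) \<and>
    1 / 2 * (\<kappa> + \<kappa> * (2 * \<omega> / real n) + 2 * (\<omega> + 1)) \<le> 1 / (\<gamma> * \<mu>) \<and>
    1 / (\<gamma> * \<mu>) \<le> 3 * (\<kappa> + \<kappa> * (2 * \<omega> / real n) + 2 * (\<omega> + 1))"
proof -
  interpret prob_space M by fact
  have one: "1 \<in> {1..n}" using assms(2) by simp
  have \<mu>: "\<mu> > 0" and L: "L > 0"
    using assms(3)[OF one] assms(4)[OF one] by (auto simp: strongly_convex_def smooth_def)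
  have \<omega>: "\<omega> \<ge> 0" using assms(7) by (rule quantization_variance_nonneg)
  have npos: "real n > 0" using assms(2) by simp
  have \<alpha>: "\<alpha> > 0" "\<alpha> * (\<omega> + 1) \<le> 1" using \<omega> by (simp_all add: assms(17))
  have c: "c \<ge> 4 * \<omega> / (\<alpha> * real n)" by (simp add: assms(16))
  \<comment> \<open>With the smallest admissible \<open>c\<close>, the factor \<open>1 + 2 \<omega> / n + c \<alpha>\<close> becomes \<open>1 + 6 \<omega> / n\<close>.\<close>
  have "c * \<alpha> = 4 * \<omega> / real n" using \<alpha> by (simp add: assms(16))
  then have \<theta>: "1 + 2 * \<omega> / real n + c * \<alpha> = 1 + 6 * \<omega> / real n" by (simp add: add_divide_distrib[symmetric])
  have \<gamma>1: "\<gamma> \<le> 2 / ((\<mu> + L) * (1 + 2 * \<omega> / real n + c * \<alpha>))"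
    unfolding \<theta> by (simp add: assms(18))
  have "\<alpha> / (2 * \<mu>) = 1 / (2 * \<mu> * (\<omega> + 1))" by (simp add: assms(17))
  then have \<gamma>2: "\<gamma> \<le> \<alpha> / (2 * \<mu>)" by (simp add: assms(18))
  have "1 + 6 * \<omega> / real n > 0" using \<omega> npos by (simp add: add_pos_nonneg)
  then have \<gamma>: "\<gamma> > 0" unfolding assms(18) using \<mu> L \<omega> by simp
  interpret diana M Z f R Q \<xi> g h x F x0 xs h0 n \<sigma> \<mu> L \<omega> \<alpha> \<gamma>
    using assms(2-10,12-14) \<gamma> by unfold_locales
  have \<Psi>: "\<Psi> k = (\<lambda>w. lyapunov n f c \<gamma> xs (x k w) (\<lambda>i. h i k w))" for k
    by (rule ext) (rule assms(20))
  have bound: "integrable M (\<Psi> k) \<and>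
      integral\<^sup>L M (\<Psi> k) \<le> (1 - \<gamma> * \<mu>) ^ k * \<Psi>0 + 2 / (\<mu> * (\<mu> + L)) * \<sigma>2" for k
    unfolding \<Psi> assms(15,21) using expected_lyapunov_bound[OF \<alpha> c \<gamma>1 \<gamma>2] by blast
  have rate: "1 / (\<gamma> * \<mu>) = max (\<kappa> + \<kappa> * (6 * \<omega> / real n)) (2 * (\<omega> + 1))"
    by (rule diana_step_size_reciprocal[OF \<mu> L npos \<omega> assms(18,19)])
  have "\<alpha> \<le> 1" using \<omega> by (simp add: assms(17))
  then have "\<gamma> * \<mu> \<le> 1" using \<gamma>2 \<mu> by (simp add: field_simps)
  moreover have "c \<ge> 0" using \<omega> \<alpha> npos by (simp add: assms(16))
  then have "\<Psi>0 \<ge> 0" unfolding assms(21) lyapunov_def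
    by (intro add_nonneg_nonneg mult_nonneg_nonneg divide_nonneg_nonneg sum_nonneg) simp_all
  ultimately have decay: "(1 - \<gamma> * \<mu>) ^ k * \<Psi>0 \<le> \<epsilon>"
    if "\<epsilon> > 0" "real k \<ge> 1 / (\<gamma> * \<mu>) * ln (\<Psi>0 / \<epsilon>)" for \<epsilon> k
    using that \<gamma> \<mu> by (intro geometric_decay_below) simp_all
  have complexity: "integral\<^sup>L M (\<Psi> k) \<le> \<epsilon> + 2 / (\<mu> * (\<mu> + L)) * \<sigma>2"
    if "\<epsilon> > 0" "real k \<ge> 1 / (\<gamma> * \<mu>) * ln (\<Psi>0 / \<epsilon>)" for \<epsilon> k
    using decay[OF that] bound[of k] by linarith
  \<comment> \<open>The maximum lies between the average and the sum of its arguments; this gives both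
    bounds up to constants.\<close>
  define t where "t = \<kappa> * (\<omega> / real n)"
  have "\<kappa> > 0" using \<mu> L by (simp add: assms(19))
  then have t: "t \<ge> 0" using \<omega> by (simp add: t_def)
  have tt: "\<kappa> * (6 * \<omega> / real n) = 6 * t" "\<kappa> * (2 * \<omega> / real n) = 2 * t" by (simp_all add: t_def)
  have "1 / 2 * (\<kappa> + \<kappa> * (2 * \<omega> / real n) + 2 * (\<omega> + 1)) \<le> 1 / (\<gamma> * \<mu>)"
    and "1 / (\<gamma> * \<mu>) \<le> 3 * (\<kappa> + \<kappa> * (2 * \<omega> / real n) + 2 * (\<omega> + 1))"
    unfolding rate tt using t \<open>\<kappa> > 0\<close> \<omega> by (simp_all add: max_def)
  then show ?thesis
    using bound complexity rate \<gamma>1 \<gamma>2 c assms(17) by blast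
qed

end
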